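(* Let $\mathbb{F}$ be a field, let $M\in \mathbb{F}^{n\times n}$ be a totally regular matrix and let $\mathbf{x}=(x_1,\dots,x_n)^T$ be a vector of distinct variables. Then any planar arithmetic circuit that computes $M\mathbf{x}$ (i.e., contains, for each $i\in[n]$, a gate computing the $i$-th entry of $M\mathbf{x}$) has size $\Omega(n^{4/3})$.
   Context: An arithmetic circuit over $\mathbb{F}$ is a directed acyclic graph whose in-degree-0 vertices (input gates) are labelled by variables or field constants and whose other vertices are labelled $+$ or $\times$; wires may be labelled by field elements, which scale the polynomial carried along them. Each gate computes a polynomial in the natural way; size is the number of gates. A circuit is planar if its underlying undirected graph is planar. A matrix is totally regular if every square submatrix of it is non-singular. *)

theory Defs
  imports
    "HOL-Analysis.Path_Connected"
    "HOL-Library.Poly_Mapping"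
    "Graph_Theory.Digraph"
    "Jordan_Normal_Form.Determinant"
    "Jordan_Normal_Form.DL_Submatrix"
begin

section \<open>Polynomials in the variables \<open>x\<^sub>0, x\<^sub>1, \<dots>\<close>\<close>

text \<open>A monomial is the finitely supported map from variable indices to exponents.\<close>

type_synonym 'a mpoly = "(nat \<Rightarrow>\<^sub>0 nat) \<Rightarrow>\<^sub>0 'a"

definition mconst :: "'a::comm_semiring_1 \<Rightarrow> 'a mpoly" where
  "mconst c = Poly_Mapping.single 0 c"

definition mvar :: "nat \<Rightarrow> 'a::comm_semiring_1 mpoly" where
  "mvar i = Poly_Mapping.single (Poly_Mapping.single i 1) 1"

section \<open>Arithmetic circuits\<close>

datatype 'a gate = Variable nat | Constant 'a | Plus | Times

fun is_input :: "'a gate \<Rightarrow> bool" where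
  "is_input (Variable _) = True"
| "is_input (Constant _) = True"
| "is_input Plus = False"
| "is_input Times = False"

text \<open>
  Fan-in and fan-out are unbounded, several input gates may carry the same variable, and parallel
  wires are allowed (so that a gate can be squared). The wire labels are a separate argument
  \<open>label\<close> of \<open>computes\<close>, on which there is no condition; a wire without a label has label 1.
\<close>

locale arithmetic_circuit = fin_digraph G for G :: "('v, 'e) pre_digraph" +
  fixes gate :: "'v \<Rightarrow> 'a::field gate"
  assumes acyclic_wires: "acyclic (arcs_ends G)"
    and input_gates: "v \<in> verts G \<Longrightarrow> in_degree G v = 0 \<longleftrightarrow> is_input (gate v)"

inductive computes ::
    "('v, 'e) pre_digraph \<Rightarrow> ('v \<Rightarrow> 'a::field gate) \<Rightarrow> ('e \<Rightarrow> 'a) \<Rightarrow> 'v \<Rightarrow> 'a mpoly \<Rightarrow> bool"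
  for G gate label where
  var_gate: "v \<in> verts G \<Longrightarrow> gate v = Variable i \<Longrightarrow> computes G gate label v (mvar i)"
| const_gate: "v \<in> verts G \<Longrightarrow> gate v = Constant c \<Longrightarrow> computes G gate label v (mconst c)"
| plus_gate: "v \<in> verts G \<Longrightarrow> gate v = Plus \<Longrightarrow>
    (\<forall>e \<in> in_arcs G v. computes G gate label (tail G e) (p e)) \<Longrightarrow>
    computes G gate label v (\<Sum>e \<in> in_arcs G v. mconst (label e) * p e)"
| times_gate: "v \<in> verts G \<Longrightarrow> gate v = Times \<Longrightarrow>
    (\<forall>e \<in> in_arcs G v. computes G gate label (tail G e) (p e)) \<Longrightarrow>
    computes G gate label v (\<Prod>e \<in> in_arcs G v. mconst (label e) * p e)"

lemma (in arithmetic_circuit) ex1_computes: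
  fixes label :: "'e \<Rightarrow> 'a"
  assumes "v \<in> verts G"
  shows "\<exists>!p. computes G gate label v p"
proof -
  have "finite (arcs_ends G)"
    by (simp add: arcs_ends_def)
  with acyclic_wires have "wf (arcs_ends G)"
    by (simp add: finite_acyclic_wf)
  then show ?thesis
    using assms
  proof (induction v rule: wf_induct_rule)
    case (less v)
    have "\<exists>!q. computes G gate label (tail G e) q" if "e \<in> in_arcs G v" for e
      using that by (intro less.IH) (auto simp: arcs_ends_conv)
    then obtain p where p: "\<And>e. e \<in> in_arcs G v \<Longrightarrow> computes G gate label (tail G e) (p e)"
      and uniq: "\<And>e q. e \<in> in_arcs G v \<Longrightarrow> computes G gate label (tail G e) q \<Longrightarrow> q = p e"
      by metis
    show ?case
    proof (cases "gate v")
      case (Variable i)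
      show ?thesis
      proof (rule ex1I)
        show "computes G gate label v (mvar i)"
          using less.prems Variable by (auto intro: computes.var_gate)
        show "q = mvar i" if "computes G gate label v q" for q
          using that Variable by cases auto
      qed
    next
      case (Constant c)
      show ?thesis
      proof (rule ex1I)
        show "computes G gate label v (mconst c)"
          using less.prems Constant by (auto intro: computes.const_gate)
        show "q = mconst c" if "computes G gate label v q" for q
          using that Constant by cases auto
      qed
    next
      case Plus
      show ?thesis
      proof (rule ex1I)
        show "computes G gate label v (\<Sum>e\<in>in_arcs G v. mconst (label e) * p e)"
          using less.prems Plus p by (auto intro: computes.plus_gate)
        show "q = (\<Sum>e\<in>in_arcs G v. mconst (label e) * p e)"
          if "computes G gate label v q" for q
          using that Plus by cases (auto intro!: sum.cong simp: uniq)
      qed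
    next
      case Times
      show ?thesis
      proof (rule ex1I)
        show "computes G gate label v (\<Prod>e\<in>in_arcs G v. mconst (label e) * p e)"
          using less.prems Times p by (auto intro: computes.times_gate)
        show "q = (\<Prod>e\<in>in_arcs G v. mconst (label e) * p e)"
          if "computes G gate label v q" for q
          using that Times by cases (auto intro!: prod.cong simp: uniq)
      qed
    qed
  qed
qed

definition computes_mult_vec ::
    "('v, 'e) pre_digraph \<Rightarrow> ('v \<Rightarrow> 'a::field gate) \<Rightarrow> ('e \<Rightarrow> 'a) \<Rightarrow> 'a mat \<Rightarrow> bool" where
  "computes_mult_vec G gate label M \<longleftrightarrow>
    (\<forall>i < dim_row M. \<exists>v \<in> verts G.
      computes G gate label v (vec_index (map_mat mconst M *\<^sub>v vec (dim_col M) mvar) i))"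

section \<open>Planarity\<close>

text \<open>
  A crossing-free drawing of the underlying undirected graph in the plane, here the complex numbers:
  an edge is a simple curve between the points of its two ends (an arc if these differ, a closed
  curve for a loop) that meets no other vertex, and two edges meet only in vertices. The orientation
  of the arcs is irrelevant, because each curve may be reversed.
\<close>

definition planar :: "('v, 'e) pre_digraph \<Rightarrow> bool" where
  "planar G \<longleftrightarrow>
    (\<exists>(pt :: 'v \<Rightarrow> complex) (\<gamma> :: 'e \<Rightarrow> real \<Rightarrow> complex).
      inj_on pt (verts G) \<and>
      (\<forall>e \<in> arcs G. simple_path (\<gamma> e) \<and>
        pathstart (\<gamma> e) = pt (tail G e) \<and> pathfinish (\<gamma> e) = pt (head G e) \<and>
        path_image (\<gamma> e) \<inter> pt ` verts G = {pt (tail G e), pt (head G e)}) \<and>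
      (\<forall>e \<in> arcs G. \<forall>f \<in> arcs G. e \<noteq> f \<longrightarrow>
        path_image (\<gamma> e) \<inter> path_image (\<gamma> f) \<subseteq> pt ` verts G))"

section \<open>Totally regular matrices\<close>

definition totally_regular :: "'a::field mat \<Rightarrow> bool" where
  "totally_regular M \<longleftrightarrow>
    (\<forall>I J. I \<subseteq> {..<dim_row M} \<longrightarrow> J \<subseteq> {..<dim_col M} \<longrightarrow> card I = card J \<longrightarrow>
      det (submatrix M I J) \<noteq> 0)"

end

theory Submission
  imports Defs "HOL-Analysis.Jordan_Curve"
begin

text \<open>
  Let \<open>s\<close> be the number of gates. If \<open>R\<close> is a set of gates with \<open>2 * card R \<le> n\<close>, then at least half
  of the variables are read by no gate of \<open>R\<close>. Let \<open>w\<close> be a vector supported on such variables on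
  which the linear parts of the polynomials at the neighbours of \<open>R\<close> vanish. By the product rule,
  the linear parts of all polynomials computed in \<open>R\<close> vanish on \<open>w\<close>. Since the square submatrices of
  \<open>M\<close> are nonsingular, \<open>R\<close> contains at most as many outputs as it has neighbours.

  On the other hand, a planar graph has no \<open>K\<^sub>6\<close> minor, hence its \<open>m\<close>-vertex subgraphs have balanced
  separators of size \<open>O(sqrt m)\<close> by the argument of Alon, Seymour and Thomas. Splitting the circuit
  recursively until the pieces have at most \<open>n / 2\<close> gates produces pieces with \<open>O(s / sqrt n)\<close>
  boundary gates in total. These bound the number \<open>n\<close> of outputs, which even gives
  \<open>s = \<Omega>(n powr (3 / 2))\<close>.
\<close>

section \<open>Separators of graphs without a clique minor\<close>

text \<open>Multiplication gates are the obstacle: intermediate polynomials need not be linear, so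
  ranks of linear maps cannot be compared directly. The derivative at the origin in a direction
  \<open>w\<close> removes the difficulty, because a product vanishes in it as soon as all factors
  do. The bound \<open>2 * card R \<le> n\<close> leaves at least \<open>card R\<close> unread
  variables, hence at least as many free columns as \<open>R\<close> has outputs, so a square
  submatrix can be singled out.

  Separators are obtained from excluded minors rather than from the faces of a drawing because that
  hypothesis passes to every vertex subset met in the recursion. The order 6 is chosen since six
  branch sets fall into two triples and thus contain \<open>K_{3,3}\<close>; planarity is then
  reduced to a single statement about theta curves, at the cost of a constant factor.\<close>

definition connected_in :: "('v \<Rightarrow> 'v \<Rightarrow> bool) \<Rightarrow> 'v set \<Rightarrow> bool" where
  "connected_in E U \<longleftrightarrow>
    U \<noteq> {} \<and> (\<forall>A. A \<subseteq> U \<and> A \<noteq> {} \<and> A \<noteq> U \<longrightarrow> (\<exists>a\<in>A. \<exists>b\<in>U - A. E a b))"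

definition nbrs :: "('v \<Rightarrow> 'v \<Rightarrow> bool) \<Rightarrow> 'v set \<Rightarrow> 'v set \<Rightarrow> 'v set" where
  "nbrs E P U = {v \<in> P - U. \<exists>u\<in>U. E u v}"

definition clique_minor :: "('v \<Rightarrow> 'v \<Rightarrow> bool) \<Rightarrow> 'v set \<Rightarrow> 'v set set \<Rightarrow> bool" where
  "clique_minor E P CC \<longleftrightarrow>
    (\<forall>C\<in>CC. C \<subseteq> P \<and> connected_in E C) \<and>
    (\<forall>C\<in>CC. \<forall>C'\<in>CC. C \<noteq> C' \<longrightarrow> C \<inter> C' = {} \<and> (\<exists>u\<in>C. \<exists>v\<in>C'. E u v))"

lemma connected_inI:
  assumes "U \<noteq> {}"
    and "\<And>A. A \<subseteq> U \<Longrightarrow> A \<noteq> {} \<Longrightarrow> A \<noteq> U \<Longrightarrow> \<exists>a\<in>A. \<exists>b\<in>U - A. E a b"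
  shows "connected_in E U"
  using assms by (auto simp: connected_in_def)

lemma connected_inD:
  assumes "connected_in E U" "A \<subseteq> U" "A \<noteq> {}" "A \<noteq> U"
  obtains a b where "a \<in> A" "b \<in> U - A" "E a b"
  using assms unfolding connected_in_def by blast

lemma connected_in_singleton: "connected_in E {v}"
  by (auto simp: connected_in_def)

text \<open>Connectivity is defined by cuts, without paths; this closure principle stands in for
  induction along a path.\<close>

lemma connected_in_subset:
  assumes "connected_in E U" "U \<inter> B \<noteq> {}"
    and "\<And>u v. u \<in> U \<inter> B \<Longrightarrow> v \<in> U \<Longrightarrow> E u v \<Longrightarrow> v \<in> B"
  shows "U \<subseteq> B"
proof (rule ccontr)
  assume "\<not> U \<subseteq> B"
  then have "U \<inter> B \<noteq> U" by blast
  with assms(1,2) obtain a b where "a \<in> U \<inter> B" "b \<in> U - U \<inter> B" "E a b"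
    using connected_inD[of E U "U \<inter> B"] by auto
  with assms(3) show False by blast
qed

lemma connected_in_Un:
  assumes "symp E" "connected_in E U" "connected_in E V" "u \<in> U" "v \<in> V" "E u v \<or> u = v"
  shows "connected_in E (U \<union> V)"
proof (rule connected_inI)
  show "U \<union> V \<noteq> {}" using assms by auto
next
  fix A assume A: "A \<subseteq> U \<union> V" "A \<noteq> {}" "A \<noteq> U \<union> V"
  show "\<exists>a\<in>A. \<exists>b\<in>U \<union> V - A. E a b"
  proof (rule ccontr)
    assume "\<not> ?thesis"
    then have closed: "\<And>a b. a \<in> A \<Longrightarrow> b \<in> U \<union> V \<Longrightarrow> E a b \<Longrightarrow> b \<in> A" by blast
    have U: "U \<subseteq> A" if "U \<inter> A \<noteq> {}"
      by (rule connected_in_subset[OF assms(2) that]) (use closed in blast)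
    have V: "V \<subseteq> A" if "V \<inter> A \<noteq> {}"
      by (rule connected_in_subset[OF assms(3) that]) (use closed in blast)
    have "u \<in> A \<longleftrightarrow> v \<in> A"
      using assms(1,4-6) closed by (meson UnI1 UnI2 sympD)
    with U V A assms(4,5) show False by blast
  qed
qed

lemma connected_in_insert:
  assumes "symp E" "connected_in E U" "u \<in> U" "E u v"
  shows "connected_in E (insert v U)"
  using connected_in_Un[OF assms(1,2) connected_in_singleton assms(3), of v v] assms(4) by auto

section \<open>Small connectors or small separators\<close>

lemma small_layer:
  fixes f :: "nat \<Rightarrow> 'v set"
  assumes "finite D" and mono: "\<And>j. f j \<subseteq> f (Suc j)" and "\<And>j. f j \<subseteq> D"
  shows "(\<Sum>j<r. card (f (Suc j) - f j)) \<le> card D"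
proof -
  have "(\<Sum>j<r. card (f (Suc j) - f j)) + card (f 0) \<le> card (f r)"
  proof (induction r)
    case (Suc r)
    have "card (f (Suc r)) = card (f r) + card (f (Suc r) - f r)"
      using assms by (metis add_diff_inverse_nat card_Diff_subset card_mono finite_subset not_le)
    with Suc show ?case by simp
  qed simp
  also have "\<dots> \<le> card D" using assms by (simp add: card_mono)
  finally show ?thesis by simp
qed

text \<open>\<open>L i j\<close> plays the role of the ball of radius \<open>j\<close> in the
  \<open>i\<close>-th of \<open>k\<close> copies of \<open>D\<close>, where one passes from copy
  \<open>i\<close> to copy \<open>i + 1\<close> at the vertices of \<open>A i\<close>, and the size
  of a connected set replaces the length of a walk. Spheres of different radii in one copy are
  disjoint, so the \<open>r\<close> sets \<open>Z j\<close> have total size at most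
  \<open>k * card D\<close>, and one of them is at most average.\<close>

lemma small_connector_or_separator:
  fixes A :: "nat \<Rightarrow> 'v set"
  assumes sym: "symp E" and fin: "finite D" and r: "r > 0"
    and no_conn: "\<And>T. T \<subseteq> D \<Longrightarrow> connected_in E T \<Longrightarrow> card T \<le> r \<Longrightarrow> \<exists>i<k. T \<inter> A i = {}"
  obtains Z where "Z \<subseteq> D" "r * card Z \<le> k * card D"
    "\<And>D'. D' \<subseteq> D - Z \<Longrightarrow> connected_in E D' \<Longrightarrow> \<exists>i<k. D' \<inter> A i = {}"
proof -
  define L where "L i j = {v. \<exists>T. T \<subseteq> D \<and> connected_in E T \<and> v \<in> T \<and> card T \<le> j \<and>
    (\<forall>l<i. T \<inter> A l \<noteq> {})}" for i j :: nat
  \<comment> \<open>A connected set avoiding \<open>Z j\<close> that meets \<open>L i (Suc j)\<close> lies in \<open>L i j\<close>, so if it also meets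
    \<open>A i\<close> then it meets \<open>L (Suc i) (Suc j)\<close>.\<close>
  define Z where "Z j = (\<Union>i<k. L i (Suc j) - L i j)" for j
  have L_I: "v \<in> L i j" if "T \<subseteq> D" "connected_in E T" "v \<in> T" "card T \<le> j"
    "\<forall>l<i. T \<inter> A l \<noteq> {}" for T v i j
    using that unfolding L_def by blast
  have L_sub: "L i j \<subseteq> D" for i j by (auto simp: L_def)
  have L_mono: "L i j \<subseteq> L i (Suc j)" for i j 
    by (auto simp: L_def intro: le_SucI)
  have L_nbr: "v \<in> L i (Suc j)" if u: "u \<in> L i j" and v: "v \<in> D" "E u v" for u v i j
  proof -
    obtain T where T: "T \<subseteq> D" "connected_in E T" "u \<in> T" "card T \<le> j" "\<forall>l<i. T \<inter> A l \<noteq> {}"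
      using u by (auto simp: L_def)
    have "connected_in E (insert v T)" using connected_in_insert sym T v by metis
    moreover have "card (insert v T) \<le> Suc j"
      using T(4) finite_subset[OF T(1) fin] by (simp add: card_insert_if)
    moreover have "\<forall>l<i. insert v T \<inter> A l \<noteq> {}" using T(5) by blast
    ultimately show ?thesis using T(1) v(1) by (intro L_I[of "insert v T"]) auto
  qed
  have L_A: "v \<in> L (Suc i) j" if "v \<in> L i j" "v \<in> A i" for v i j
  proof -
    obtain T where T: "T \<subseteq> D" "connected_in E T" "v \<in> T" "card T \<le> j" "\<forall>l<i. T \<inter> A l \<noteq> {}"
      using \<open>v \<in> L i j\<close> by (auto simp: L_def)
    then have "\<forall>l<Suc i. T \<inter> A l \<noteq> {}" using that(2) by (auto simp: less_Suc_eq)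
    with T show ?thesis by (intro L_I[of T])
  qed
  have L_k: "L k j = {}" if "j \<le> r" for j
  proof (rule ccontr)
    assume "L k j \<noteq> {}"
    then obtain T where "T \<subseteq> D" "connected_in E T" "card T \<le> j" "\<forall>l<k. T \<inter> A l \<noteq> {}"
      by (auto simp: L_def)
    with no_conn[of T] that show False by auto
  qed
  have "(\<Sum>j<r. card (Z j)) \<le> (\<Sum>j<r. \<Sum>i<k. card (L i (Suc j) - L i j))"
    unfolding Z_def by (intro sum_mono card_UN_le) auto
  also have "\<dots> = (\<Sum>i<k. \<Sum>j<r. card (L i (Suc j) - L i j))" by (rule sum.swap)
  also have "\<dots> \<le> (\<Sum>i<k. card D)"
    by (intro sum_mono small_layer[OF fin]) (use L_mono L_sub in auto)
  finally have sum: "(\<Sum>j<r. card (Z j)) \<le> k * card D" by simp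
  have "\<exists>j<r. r * card (Z j) \<le> k * card D"
  proof (rule ccontr)
    assume "\<not> ?thesis"
    then have "(\<Sum>j<r. k * card D) < (\<Sum>j<r. r * card (Z j))"
      using r by (intro sum_strict_mono) auto
    also have "\<dots> = r * (\<Sum>j<r. card (Z j))" by (simp add: sum_distrib_left)
    also have "\<dots> \<le> r * (k * card D)" using sum by simp
    finally show False by simp
  qed
  then obtain j where j: "j < r" "r * card (Z j) \<le> k * card D" by blast
  show ?thesis
  proof (rule that[of "Z j"])
    show "Z j \<subseteq> D" using L_sub by (auto simp: Z_def)
    show "r * card (Z j) \<le> k * card D" by fact
    fix D' assume D': "D' \<subseteq> D - Z j" "connected_in E D'"
    show "\<exists>i<k. D' \<inter> A i = {}"
    proof (rule ccontr)
      assume "\<not> ?thesis"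
      then have meets: "\<And>i. i < k \<Longrightarrow> D' \<inter> A i \<noteq> {}" by blast
      have "D' \<inter> L i (Suc j) \<noteq> {}" if "i \<le> k" for i
        using that
      proof (induction i)
        case 0
        obtain v where "v \<in> D'" using D'(2) by (auto simp: connected_in_def)
        then have "v \<in> L 0 (Suc j)"
          using D' connected_in_singleton[of E v] by (intro L_I[of "{v}"]) auto
        with \<open>v \<in> D'\<close> show ?case by blast
      next
        case (Suc i)
        have Zi: "D' \<inter> (L i (Suc j) - L i j) = {}"
          using D'(1) Suc.prems by (fastforce simp: Z_def)
        have "D' \<subseteq> L i j"
        proof (rule connected_in_subset[OF D'(2)])
          show "D' \<inter> L i j \<noteq> {}" using Suc Zi by fastforce
          show "v \<in> L i j" if "u \<in> D' \<inter> L i j" "v \<in> D'" "E u v" for u v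
            using L_nbr[of u i j v] that D'(1) Zi by blast
        qed
        with meets[of i] Suc.prems L_A[of _ i j] L_mono[of "Suc i" j] show ?case by fastforce
      qed
      from this[of k] L_k[of "Suc j"] j show False by auto
    qed
  qed
qed

section \<open>Clique minors in the absence of balanced separators\<close>

context
  fixes E :: "'v \<Rightarrow> 'v \<Rightarrow> bool" and P :: "'v set" and h b :: nat
  assumes sym: "symp E" and fin: "finite P"
    and no_minor: "\<And>CC. clique_minor E P CC \<Longrightarrow> card CC \<noteq> h"
    and b: "h * card P \<le> b * b"
    and no_sep: "\<And>A B. A \<union> B = P \<Longrightarrow> card (A \<inter> B) \<le> h * b \<Longrightarrow>
      (\<And>u v. u \<in> A - B \<Longrightarrow> v \<in> B - A \<Longrightarrow> \<not> E u v) \<Longrightarrow> 3 * card A < card P \<or> 3 * card B < card P"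
begin

text \<open>\<open>D\<close> is a smallest union of components of \<open>P - X\<close> with at least
  a third of the vertices. The separation into \<open>D \<union> X\<close> and \<open>P - D\<close>
  leaves less than a third outside \<open>D\<close>. If \<open>D\<close> fell apart, by minimality
  each part would have less than a third, hence both together less than two thirds.\<close>

lemma big_component:
  assumes X: "X \<subseteq> P" "card X \<le> h * b"
  obtains D where "D \<subseteq> P - X" "connected_in E D" "nbrs E P D \<subseteq> X" "2 * card P < 3 * card D"
proof -
  define good where "good U \<longleftrightarrow> U \<subseteq> P - X \<and> nbrs E P U \<subseteq> X \<and> card P \<le> 3 * card U" for U
  have finX: "finite X" using X fin finite_subset by blast
  \<comment> \<open>The separation into \<open>X\<close> and \<open>P\<close> shows that
    \<open>X\<close> is small, which makes \<open>P - X\<close> a first candidate.\<close>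
  have "3 * card X < card P"
    using no_sep[of X P] X by (auto simp: Int_absorb2)
  moreover have "card (P - X) = card P - card X"
    using X finX by (simp add: card_Diff_subset)
  ultimately have "good (P - X)"
    unfolding good_def nbrs_def by auto
  then obtain D where D: "good D" and min: "\<And>U. good U \<Longrightarrow> card D \<le> card U"
    using ex_has_least_nat[of good "P - X" card] by auto
  have finD: "finite D" "D \<subseteq> P" using D fin finite_subset unfolding good_def by blast+
  have big: "2 * card P < 3 * card D"
  proof -
    have "card (D \<union> X \<union> (P - D)) = card P" "D \<union> X \<union> (P - D) = P"
      using D X unfolding good_def by (auto intro!: arg_cong[of _ _ card])
    moreover have "(D \<union> X) \<inter> (P - D) = X" using D X unfolding good_def by auto
    moreover have "\<not> E u v" if "u \<in> (D \<union> X) - (P - D)" "v \<in> (P - D) - (D \<union> X)" for u v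
      using that D X unfolding good_def nbrs_def by blast
    ultimately have "3 * card (D \<union> X) < card P \<or> 3 * card (P - D) < card P"
      using no_sep[of "D \<union> X" "P - D"] X by auto
    moreover have "card D \<le> card (D \<union> X)" using finD finX by (intro card_mono) auto
    moreover have "card (P - D) + card D = card P"
      using finD fin by (simp add: card_Diff_subset card_mono)
    ultimately show ?thesis using D unfolding good_def by linarith
  qed
  have "connected_in E D"
  proof (rule connected_inI)
    show "D \<noteq> {}" using big by auto
  next
    fix A assume A: "A \<subseteq> D" "A \<noteq> {}" "A \<noteq> D"
    show "\<exists>a\<in>A. \<exists>c\<in>D - A. E a c"
    proof (rule ccontr)
      assume no: "\<not> ?thesis"
      have nA: "nbrs E P A \<subseteq> X" using D A(1) no unfolding good_def nbrs_def by blast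
      have nB: "nbrs E P (D - A) \<subseteq> X"
        using D A(1) no sympD[OF sym] unfolding good_def nbrs_def by blast
      have card: "card (D - A) + card A = card D"
        using A(1) finD by (simp add: card_Diff_subset card_mono finite_subset)
      have "card A > 0" "card (D - A) > 0"
        using A finD by (auto simp: card_gt_0_iff intro: finite_subset)
      with card min[of A] min[of "D - A"] have "\<not> good A" "\<not> good (D - A)" by auto
      with nA nB D A(1) have "3 * card A < card P" "3 * card (D - A) < card P"
        unfolding good_def by auto
      with card big show False by linarith
    qed
  qed
  with D big show ?thesis using that unfolding good_def by blast
qed

text \<open>
  The invariant of the argument of Alon, Seymour and Thomas: a clique minor that separates the big
  component \<open>D\<close> from the rest and has few neighbours of \<open>D\<close> in each member.
\<close>

definition covey :: "'v set set \<Rightarrow> 'v set \<Rightarrow> bool" where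
  "covey CC D \<longleftrightarrow> clique_minor E P CC \<and> card CC < h \<and>
    D \<subseteq> P \<and> connected_in E D \<and> 2 * card P < 3 * card D \<and>
    (\<forall>C\<in>CC. C \<inter> D = {}) \<and> nbrs E P D \<subseteq> \<Union>CC \<and> (\<forall>C\<in>CC. card (nbrs E P D \<inter> C) \<le> b)"

lemma finite_clique_minor: "clique_minor E P CC \<Longrightarrow> finite CC"
  unfolding clique_minor_def using fin by (metis PowI finite_Pow_iff finite_subset subsetI)

text \<open>Since \<open>card CC < h\<close>, the budget \<open>h * b\<close> has room for
  \<open>b\<close> further vertices, so \<open>big_component\<close> still applies after a set
  \<open>T\<close> or \<open>Z\<close> of at most that size is added to the neighbours of
  \<open>D\<close>.\<close>

lemma card_nbrs_covey:
  assumes "covey CC D"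
  shows "card (nbrs E P D) + b \<le> h * b"
proof -
  have "nbrs E P D = (\<Union>C\<in>CC. nbrs E P D \<inter> C)"
    using assms by (auto simp: covey_def)
  also have "card \<dots> \<le> (\<Sum>C\<in>CC. card (nbrs E P D \<inter> C))"
    using assms by (intro card_UN_le finite_clique_minor) (simp add: covey_def)
  also have "\<dots> \<le> (\<Sum>C\<in>CC. b)" using assms by (intro sum_mono) (simp add: covey_def)
  finally have "card (nbrs E P D) + b \<le> Suc (card CC) * b" by simp
  also have "\<dots> \<le> h * b" using assms by (intro mult_right_mono) (auto simp: covey_def)
  finally show ?thesis .
qed

lemma covey_minus:
  assumes cov: "covey CC D" and C: "C \<in> CC" "\<And>u v. u \<in> C \<Longrightarrow> v \<in> D \<Longrightarrow> \<not> E u v"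
  shows "covey (CC - {C}) D"
proof -
  have "nbrs E P D \<inter> C = {}" using C sympD[OF sym] by (auto simp: nbrs_def)
  moreover have "clique_minor E P (CC - {C})" using cov by (auto simp: covey_def clique_minor_def)
  moreover have "card (CC - {C}) < h"
    using cov by (meson card_Diff1_le covey_def finite_clique_minor le_less_trans)
  moreover have "nbrs E P D \<subseteq> \<Union>(CC - {C})"
    using cov \<open>nbrs E P D \<inter> C = {}\<close> unfolding covey_def by blast
  ultimately show ?thesis using cov by (simp add: covey_def)
qed

lemma clique_minor_insert:
  assumes "clique_minor E P CC" "T \<subseteq> P" "connected_in E T"
    and "\<And>C. C \<in> CC \<Longrightarrow> C \<inter> T = {} \<and> (\<exists>u\<in>C. \<exists>v\<in>T. E u v)"
  shows "clique_minor E P (insert T CC)"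
proof -
  have pair: "C \<inter> C' = {}" "\<exists>u\<in>C. \<exists>v\<in>C'. E u v"
    if C: "C \<in> insert T CC" "C' \<in> insert T CC" "C \<noteq> C'" for C C'
  proof -
    consider "C \<in> CC" "C' \<in> CC" | "C = T" "C' \<in> CC" | "C \<in> CC" "C' = T"
      using C by blast
    then have "C \<inter> C' = {} \<and> (\<exists>u\<in>C. \<exists>v\<in>C'. E u v)"
    proof cases
      case 1
      then show ?thesis using assms(1) C(3) by (simp add: clique_minor_def)
    next
      case 2
      then show ?thesis using assms(4)[of C'] sympD[OF sym] by blast
    next
      case 3
      then show ?thesis using assms(4)[of C] by blast
    qed
    then show "C \<inter> C' = {}" "\<exists>u\<in>C. \<exists>v\<in>C'. E u v" by blast+
  qed
  have sub: "C \<subseteq> P" and con: "connected_in E C" if "C \<in> insert T CC" for C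
    using that assms(1-3) by (auto simp: clique_minor_def)
  show ?thesis unfolding clique_minor_def by (intro conjI ballI impI pair sub con)
qed

text \<open>Any two sets with more than two thirds of the vertices meet.\<close>

lemma big_component_subset:
  assumes cov: "covey CC D" and X: "nbrs E P D \<subseteq> X"
    and D': "D' \<subseteq> P - X" "connected_in E D'" "2 * card P < 3 * card D'"
  shows "D' \<subseteq> D"
proof (rule connected_in_subset[OF D'(2)])
  show "D' \<inter> D \<noteq> {}"
  proof
    assume "D' \<inter> D = {}"
    moreover have "D \<subseteq> P" "D' \<subseteq> P" using D' cov by (auto simp: covey_def)
    ultimately have "card D' + card D \<le> card P"
      using fin by (metis card_Un_disjoint card_mono finite_subset Un_least)
    then show False using D'(3) cov by (auto simp: covey_def)
  qed
  show "v \<in> D" if "u \<in> D' \<inter> D" "v \<in> D'" "E u v" for u v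
    using that X D'(1) by (auto simp: nbrs_def)
qed

text \<open>Old members keep at most the neighbours that they had, and the new member has at most
  \<open>b\<close> vertices altogether. The number of members stays below \<open>h\<close> because a
  minor of order \<open>h\<close> is excluded.\<close>

lemma covey_insert:
  assumes cov: "covey CC D" and T: "T \<subseteq> D" "connected_in E T" "card T \<le> b"
    and meets: "\<And>C. C \<in> CC \<Longrightarrow> \<exists>u\<in>C. \<exists>v\<in>T. E u v"
  obtains D' where "covey (insert T CC) D'" "D' \<subset> D"
proof -
  let ?X = "nbrs E P D \<union> T"
  have T0: "T \<noteq> {}" using T by (auto simp: connected_in_def)
  have DP: "D \<subseteq> P" using cov by (simp add: covey_def)
  have "?X \<subseteq> P" using T DP by (auto simp: nbrs_def)
  moreover have "card ?X \<le> h * b"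
    using card_nbrs_covey[OF cov] T(3) card_Un_le[of "nbrs E P D" T] by linarith
  ultimately obtain D' where D': "D' \<subseteq> P - ?X" "connected_in E D'" "nbrs E P D' \<subseteq> ?X"
    "2 * card P < 3 * card D'"
    using big_component by metis
  have sub: "D' \<subseteq> D" by (rule big_component_subset[OF cov _ D'(1,2,4)]) auto
  have TCC: "C \<inter> T = {}" if "C \<in> CC" for C
    using cov that T(1) unfolding covey_def by blast
  have minor: "clique_minor E P (insert T CC)"
    by (rule clique_minor_insert) (use cov T(1,2) meets DP TCC in \<open>auto simp: covey_def\<close>)
  have "covey (insert T CC) D'"
    unfolding covey_def
  proof (intro conjI ballI)
    have "card (insert T CC) \<le> Suc (card CC)"
      using cov by (simp add: card_insert_if covey_def finite_clique_minor)
    moreover have "card CC < h" using cov by (simp add: covey_def)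
    moreover have "card (insert T CC) \<noteq> h" using no_minor minor .
    ultimately show "card (insert T CC) < h" by linarith
    show "nbrs E P D' \<subseteq> \<Union>(insert T CC)" using cov D'(3) by (auto simp: covey_def)
    show "C \<inter> D' = {}" if "C \<in> insert T CC" for C
      using that cov sub D'(1) unfolding covey_def by blast
    show "card (nbrs E P D' \<inter> C) \<le> b" if "C \<in> insert T CC" for C
    proof (cases "C = T")
      case True
      have "card (nbrs E P D' \<inter> C) \<le> card T"
        using True T DP fin by (intro card_mono) (auto intro: finite_subset)
      then show ?thesis using T(3) by simp
    next
      case False
      with that have C: "C \<in> CC" by blast
      then have "nbrs E P D' \<inter> C \<subseteq> nbrs E P D \<inter> C" using D'(3) TCC by blast
      then have "card (nbrs E P D' \<inter> C) \<le> card (nbrs E P D \<inter> C)"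
        using fin by (intro card_mono) (auto simp: nbrs_def)
      also have "\<dots> \<le> b" using cov C by (simp add: covey_def)
      finally show ?thesis .
    qed
  qed (use minor D' DP sub in auto)
  moreover have "D' \<noteq> D" using D'(1) T T0 by blast
  ultimately show ?thesis using that sub by blast
qed

text \<open>\<open>Z\<close> separates some member \<open>C\<close> from the large component
  \<open>D1\<close>. The vertices of \<open>Z\<close> next to \<open>D1\<close> belong to no member,
  so \<open>D1\<close> cannot simply replace \<open>D\<close>; instead \<open>C\<close> grows until
  it covers those that stay outside the new component.\<close>

lemma covey_enlarge:
  assumes cov: "covey CC D" and Z: "Z \<subseteq> D" "card Z \<le> b"
    and miss: "\<And>D'. D' \<subseteq> D - Z \<Longrightarrow> connected_in E D' \<Longrightarrow>
      \<exists>C\<in>CC. \<forall>u\<in>C. \<forall>v\<in>D'. \<not> E u v"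
    and meets: "\<And>C. C \<in> CC \<Longrightarrow> \<exists>u\<in>C. \<exists>v\<in>D. E u v"
  obtains CC' D' where "covey CC' D'" "D' \<subset> D"
proof -
  let ?X = "nbrs E P D \<union> Z"
  have DP: "D \<subseteq> P" using cov by (simp add: covey_def)
  have conD: "connected_in E D" using cov by (simp add: covey_def)
  have "?X \<subseteq> P" using Z DP by (auto simp: nbrs_def)
  moreover have "card ?X \<le> h * b"
    using card_nbrs_covey[OF cov] Z(2) card_Un_le[of "nbrs E P D" Z] by linarith
  ultimately obtain D1 where D1: "D1 \<subseteq> P - ?X" "connected_in E D1" "nbrs E P D1 \<subseteq> ?X"
    "2 * card P < 3 * card D1"
    using big_component by metis
  have sub: "D1 \<subseteq> D" by (rule big_component_subset[OF cov _ D1(1,2,4)]) auto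
  then have "D1 \<subseteq> D - Z" using D1(1) by blast
  then obtain C where C: "C \<in> CC" "\<And>u v. u \<in> C \<Longrightarrow> v \<in> D1 \<Longrightarrow> \<not> E u v"
    using miss[OF _ D1(2)] by blast
  have conC: "connected_in E C" and CP: "C \<subseteq> P" and CD: "C \<inter> D = {}"
    using cov C(1) by (auto simp: covey_def clique_minor_def)
  \<comment> \<open>\<open>C\<close> absorbs the vertices of \<open>D - D1\<close> that it reaches; those it does not reach stay connected to
    \<open>D1\<close>. In this way every neighbour of the new component that is not an old one lies in \<open>Z\<close>.\<close>
  define W where "W = \<Union>{W. W \<subseteq> D - D1 \<and> connected_in E (C \<union> W)}"
  have W_sub: "W \<subseteq> D - D1" by (auto simp: W_def)
  have conW: "connected_in E (C \<union> W)"
  proof (rule connected_inI)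
    show "C \<union> W \<noteq> {}" using conC by (auto simp: connected_in_def)
    fix A assume A: "A \<subseteq> C \<union> W" "A \<noteq> {}" "A \<noteq> C \<union> W"
    show "\<exists>a\<in>A. \<exists>c\<in>C \<union> W - A. E a c"
    proof (rule ccontr)
      assume "\<not> ?thesis"
      then have closed: "\<And>a c. a \<in> A \<Longrightarrow> c \<in> C \<union> W \<Longrightarrow> E a c \<Longrightarrow> c \<in> A" by blast
      have in_A: "C \<union> W' \<subseteq> A" if W': "W' \<subseteq> D - D1" "connected_in E (C \<union> W')"
        and ne: "(C \<union> W') \<inter> A \<noteq> {}" for W'
      proof (rule connected_in_subset[OF W'(2) ne])
        show "v \<in> A" if "u \<in> (C \<union> W') \<inter> A" "v \<in> C \<union> W'" "E u v" for u v
        proof -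
          have "v \<in> C \<union> W" using that(2) W' unfolding W_def by blast
          then show ?thesis using closed that by blast
        qed
      qed
      have "C \<noteq> {}" using conC by (auto simp: connected_in_def)
      from A obtain a where a: "a \<in> A" "a \<in> C \<union> W" by blast
      have "C \<subseteq> A"
      proof (cases "a \<in> C")
        case True
        then show ?thesis using in_A[of "{}"] conC a by auto
      next
        case False
        then obtain W' where "W' \<subseteq> D - D1" "connected_in E (C \<union> W')" "a \<in> W'"
          using a unfolding W_def by blast
        then show ?thesis using in_A[of W'] a by blast
      qed
      then have "W \<subseteq> A" using in_A \<open>C \<noteq> {}\<close> unfolding W_def by blast
      with \<open>C \<subseteq> A\<close> A show False by blast
    qed
  qed
  have W_max: "v \<in> W" if "u \<in> C \<union> W" "v \<in> D - D1" "E u v" for u v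
  proof -
    have "connected_in E (C \<union> insert v W)"
      using connected_in_insert[OF sym conW that(1,3)] by simp
    moreover have "insert v W \<subseteq> D - D1" using that(2) W_sub by blast
    ultimately have "insert v W \<subseteq> W" unfolding W_def by (intro Union_upper) simp
    then show ?thesis by blast
  qed
  define D2 where "D2 = D - W"
  have D12: "D1 \<subseteq> D2" using sub W_sub by (auto simp: D2_def)
  \<comment> \<open>By connectivity of \<open>D\<close>, such an \<open>A\<close> has an edge into
    \<open>W\<close>. Its end in \<open>A\<close> lies outside \<open>D1\<close> and would have been
    absorbed into \<open>W\<close>.\<close>
  have not_closed: False
    if A: "A \<subseteq> D2" "A \<noteq> {}" "A \<inter> D1 = {}"
      and closed: "\<And>a c. a \<in> A \<Longrightarrow> c \<in> D2 - A \<Longrightarrow> \<not> E a c" for A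
  proof -
    have "D1 \<noteq> {}" using D1(4) by auto
    then have "A \<noteq> D" using A(3) sub by blast
    then obtain a c where ac: "a \<in> A" "c \<in> D - A" "E a c"
      using connected_inD[OF conD, of A] A(1,2) by (auto simp: D2_def)
    then have "c \<in> W" using closed by (auto simp: D2_def)
    then have "a \<in> W" using W_max[of c a] ac A sympD[OF sym ac(3)] by (auto simp: D2_def)
    then show False using ac A by (auto simp: D2_def)
  qed
  have conD2: "connected_in E D2"
  proof (rule connected_inI)
    show "D2 \<noteq> {}" using D12 D1(2) by (auto simp: connected_in_def)
    fix A assume A: "A \<subseteq> D2" "A \<noteq> {}" "A \<noteq> D2"
    show "\<exists>a\<in>A. \<exists>c\<in>D2 - A. E a c"
    proof (rule ccontr)
      assume "\<not> ?thesis"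
      then have closed: "\<And>a c. a \<in> A \<Longrightarrow> c \<in> D2 - A \<Longrightarrow> \<not> E a c" by blast
      show False
      proof (cases "A \<inter> D1 = {}")
        case True
        then show False using not_closed[of A] A closed by blast
      next
        case False
        have "D1 \<subseteq> A"
          by (rule connected_in_subset[OF D1(2)]) (use False closed D12 in blast)+
        then show False
          using not_closed[of "D2 - A"] A closed sympD[OF sym] by blast
      qed
    qed
  qed
  \<comment> \<open>A vertex of \<open>C \<union> W\<close> next to \<open>D2\<close> is next to
    \<open>D1\<close> only, as any other neighbour in \<open>D2\<close> would have been absorbed. No
    vertex of \<open>C\<close> is next to \<open>D1\<close>, and a vertex of \<open>W\<close> next
    to \<open>D1\<close> lies in \<open>Z\<close>.\<close>
  have N: "nbrs E P D2 \<subseteq> (nbrs E P D - C) \<union> (W \<inter> Z)"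
  proof
    fix v assume "v \<in> nbrs E P D2"
    then obtain u where u: "u \<in> D2" "E u v" and v: "v \<in> P" "v \<notin> D2" by (auto simp: nbrs_def)
    have vu: "E v u" using sympD[OF sym u(2)] .
    have "u \<notin> D1 \<Longrightarrow> v \<notin> C \<union> W"
      using W_max[OF _ _ vu] u(1) by (auto simp: D2_def)
    then have u1: "u \<in> D1" if "v \<in> C \<union> W" using that by blast
    show "v \<in> (nbrs E P D - C) \<union> (W \<inter> Z)"
    proof (cases "v \<in> D")
      case True
      then have "v \<in> W" using v by (auto simp: D2_def)
      then have "v \<in> nbrs E P D1" using u1 u W_sub v by (auto simp: nbrs_def)
      then show ?thesis using D1(3) True \<open>v \<in> W\<close> by (auto simp: nbrs_def)
    next
      case False
      then have "v \<notin> C" using u1 C(2)[of v u] vu by blast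
      then show ?thesis using False u v by (auto simp: nbrs_def D2_def)
    qed
  qed
  let ?CC = "insert (C \<union> W) (CC - {C})"
  have disj: "C' \<inter> C = {} \<and> C' \<inter> D = {} \<and> (\<exists>u\<in>C'. \<exists>v\<in>C. E u v)" if "C' \<in> CC - {C}" for C'
  proof -
    have "clique_minor E P CC" "C' \<inter> D = {}" using cov that by (auto simp: covey_def)
    then show ?thesis using C(1) that by (simp add: clique_minor_def)
  qed
  have "clique_minor E P ?CC"
  proof (rule clique_minor_insert)
    show "clique_minor E P (CC - {C})" using cov by (auto simp: covey_def clique_minor_def)
    show "C \<union> W \<subseteq> P" using CP W_sub DP by blast
    show "C' \<inter> (C \<union> W) = {} \<and> (\<exists>u\<in>C'. \<exists>v\<in>C \<union> W. E u v)" if "C' \<in> CC - {C}" for C'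
      using disj[OF that] W_sub by blast
  qed (rule conW)
  moreover have "card ?CC < h"
  proof -
    have f: "finite CC" using cov finite_clique_minor by (auto simp: covey_def)
    then have "card ?CC \<le> Suc (card (CC - {C}))" by (simp add: card_insert_if)
    also have "\<dots> = card CC" by (rule card_Suc_Diff1[OF f C(1)])
    finally show ?thesis using cov by (simp add: covey_def)
  qed
  moreover have "D2 \<subseteq> P" using DP by (auto simp: D2_def)
  moreover have "2 * card P < 3 * card D2"
    using D1(4) card_mono[OF _ D12] finite_subset[OF \<open>D2 \<subseteq> P\<close> fin] by linarith
  moreover have d1: "C' \<inter> D2 = {}" if "C' \<in> ?CC" for C'
    using that disj CD by (auto simp: D2_def)
  moreover have "nbrs E P D2 \<subseteq> \<Union>?CC"
  proof -
    have "nbrs E P D \<subseteq> \<Union>CC" using cov by (simp add: covey_def)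
    then show ?thesis using N by blast
  qed
  moreover have d2: "card (nbrs E P D2 \<inter> C') \<le> b" if "C' \<in> ?CC" for C'
  proof (cases "C' = C \<union> W")
    case True
    have "nbrs E P D \<inter> W = {}" using W_sub by (auto simp: nbrs_def)
    then have "nbrs E P D2 \<inter> C' \<subseteq> Z" using N True by blast
    then have "card (nbrs E P D2 \<inter> C') \<le> card Z"
      using Z DP fin by (intro card_mono) (auto intro: finite_subset)
    then show ?thesis using Z(2) by simp
  next
    case False
    with that have C': "C' \<in> CC - {C}" by blast
    have "nbrs E P D2 \<inter> C' \<subseteq> nbrs E P D \<inter> C'" using N disj[OF C'] W_sub by blast
    then have "card (nbrs E P D2 \<inter> C') \<le> card (nbrs E P D \<inter> C')"
      using fin by (intro card_mono) (auto simp: nbrs_def)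
    also have "\<dots> \<le> b" using cov C' by (simp add: covey_def)
    finally show ?thesis .
  qed
  ultimately have "covey ?CC D2"
    unfolding covey_def by (intro conjI ballI d1 d2 conD2)
  \<comment> \<open>\<open>C\<close> has a neighbour in \<open>D\<close>, which is outside
    \<open>D1\<close> and hence absorbed; this makes \<open>D2\<close> strictly smaller than
    \<open>D\<close>.\<close>
  moreover have "W \<noteq> {}"
  proof -
    obtain u v where "u \<in> C" "v \<in> D" "E u v" using meets[OF C(1)] by blast
    then show ?thesis using W_max[of u v] C(2)[of u v] by blast
  qed
  then have "D2 \<subset> D" using W_sub by (auto simp: D2_def)
  ultimately show ?thesis using that by blast
qed

text \<open>As \<open>card CC < h\<close>, the measure orders the pairs of \<open>card D\<close> and
  \<open>card CC\<close> lexicographically: members may be added as long as \<open>D\<close>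
  shrinks. The moves are to drop a member without neighbours in \<open>D\<close>, to add a small
  connector, or to enlarge a member along a small separator.\<close>

lemma covey_descend:
  assumes cov: "covey CC D"
  obtains CC' D' where "covey CC' D'" "h * card D' + card CC' < h * card D + card CC"
proof -
  have finD: "finite D" and finCC: "finite CC"
    using cov fin finite_clique_minor by (auto simp: covey_def intro: finite_subset)
  have smaller: "h * card D' + card CC' < h * card D + card CC"
    if "covey CC' D'" "D' \<subset> D" for CC' D'
  proof -
    have "card D' < card D" using that finD by (simp add: psubset_card_mono)
    then have "h * Suc (card D') \<le> h * card D" by (intro mult_left_mono) auto
    moreover have "card CC' < h" using that by (simp add: covey_def)
    ultimately show ?thesis by simp
  qed
  show ?thesis
  proof (cases "\<exists>C\<in>CC. \<forall>u\<in>C. \<forall>v\<in>D. \<not> E u v")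
    case True
    then obtain C where C: "C \<in> CC" "\<And>u v. u \<in> C \<Longrightarrow> v \<in> D \<Longrightarrow> \<not> E u v" by blast
    then have "covey (CC - {C}) D" by (rule covey_minus[OF cov])
    moreover have "card (CC - {C}) < card CC" using C(1) finCC by (intro card_Diff1_less)
    ultimately show ?thesis using that by simp
  next
    case False
    then have meets: "\<And>C. C \<in> CC \<Longrightarrow> \<exists>u\<in>C. \<exists>v\<in>D. E u v" by blast
    obtain g where g: "bij_betw g {..<card CC} CC"
      using finCC by (metis ex_bij_betw_nat_finite atLeast0LessThan)
    then have g_CC: "g i \<in> CC" if "i < card CC" for i
      using that by (auto simp: bij_betw_def)
    have CC_g: "\<exists>i<card CC. C = g i" if "C \<in> CC" for C
      using that g by (auto simp: bij_betw_def)
    \<comment> \<open>A set meets \<open>A i\<close> exactly when it touches the member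
      \<open>g i\<close>, so a connector of all the \<open>A i\<close> is fit to be a new
      member.\<close>
    define A where "A i = {v. \<exists>u\<in>g i. E u v}" for i
    show ?thesis
    proof (cases "\<exists>T. T \<subseteq> D \<and> connected_in E T \<and> card T \<le> b \<and> (\<forall>i<card CC. T \<inter> A i \<noteq> {})")
      case True
      then obtain T where T: "T \<subseteq> D" "connected_in E T" "card T \<le> b"
        "\<And>i. i < card CC \<Longrightarrow> T \<inter> A i \<noteq> {}" by blast
      have "\<exists>u\<in>C. \<exists>v\<in>T. E u v" if "C \<in> CC" for C
        using CC_g[OF that] T(4) unfolding A_def by blast
      from covey_insert[OF cov T(1-3) this] that smaller show ?thesis by metis
    next
      case False
      have "card CC < h" "0 < card D" using cov by (auto simp: covey_def)
      then have "0 < card P" using cov fin by (metis card_mono covey_def leD not_gr_zero le_zero_eq)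
      then have "0 < b" using b \<open>card CC < h\<close> by (cases b) auto
      obtain Z where Z: "Z \<subseteq> D" "b * card Z \<le> card CC * card D"
        "\<And>D'. D' \<subseteq> D - Z \<Longrightarrow> connected_in E D' \<Longrightarrow> \<exists>i<card CC. D' \<inter> A i = {}"
      proof (rule small_connector_or_separator[OF sym finD \<open>0 < b\<close>, of "card CC" A])
        show "\<exists>i<card CC. T \<inter> A i = {}" if "T \<subseteq> D" "connected_in E T" "card T \<le> b" for T
          using False that by blast
      qed blast
      \<comment> \<open>Here \<open>b\<close> is balanced: connectors have at most \<open>b\<close>
        vertices, separators at most \<open>h * card P / b\<close>, and
        \<open>h * card P \<le> b * b\<close> puts these below \<open>b\<close> as well.\<close>
      have "b * card Z \<le> h * card P"
        using Z(2) \<open>card CC < h\<close> card_mono[OF fin, of D] cov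
        by (meson covey_def le_trans less_imp_le mult_le_mono)
      with b \<open>0 < b\<close> have "card Z \<le> b" by (metis le_trans mult_le_cancel1)
      moreover have "\<exists>C\<in>CC. \<forall>u\<in>C. \<forall>v\<in>D'. \<not> E u v"
        if D': "D' \<subseteq> D - Z" "connected_in E D'" for D'
      proof -
        obtain i where "i < card CC" "D' \<inter> A i = {}" using Z(3)[OF D'] by blast
        then show ?thesis unfolding A_def by (intro bexI[of _ "g i"] g_CC) blast+
      qed
      ultimately obtain CC' D' where "covey CC' D'" "D' \<subset> D"
        using covey_enlarge[OF cov Z(1) _ _ meets] by metis
      then show ?thesis using that smaller by metis
    qed
  qed
qed

lemma no_covey: "\<not> covey CC D"
proof (induction "h * card D + card CC" arbitrary: CC D rule: less_induct)
  case less
  then show ?case using covey_descend by metis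
qed

lemma separator_contradiction: False
proof -
  \<comment> \<open>The empty family is a clique minor of order 0. It also starts the descent,
    together with a big component of \<open>P\<close> itself.\<close>
  have h: "h \<noteq> 0" using no_minor[of "{}"] by (auto simp: clique_minor_def)
  obtain D where D: "D \<subseteq> P" "connected_in E D" "nbrs E P D \<subseteq> {}" "2 * card P < 3 * card D"
    using big_component[of "{}"] by auto
  then have "covey {} D" using h by (auto simp: covey_def clique_minor_def)
  then show False using no_covey by blast
qed

end

text \<open>With \<open>b\<close> close to \<open>sqrt (h * card P)\<close> the separator has order
  \<open>h powr (3 / 2) * sqrt (card P)\<close>. Both sides include it, so balance is stated as a
  lower bound, and that the sides shrink has to be derived from the size of the separator.\<close>

theorem minor_free_separator:
  fixes E :: "'v \<Rightarrow> 'v \<Rightarrow> bool"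
  assumes "symp E" "finite P" "\<And>CC. clique_minor E P CC \<Longrightarrow> card CC \<noteq> h" "h * card P \<le> b * b"
  obtains (good) A B where "A \<union> B = P" "card (A \<inter> B) \<le> h * b"
    "\<And>u v. u \<in> A - B \<Longrightarrow> v \<in> B - A \<Longrightarrow> \<not> E u v" "card P \<le> 3 * card A" "card P \<le> 3 * card B"
proof (rule ccontr)
  assume no: "\<not> thesis"
  have "3 * card A < card P \<or> 3 * card B < card P"
    if "A \<union> B = P" "card (A \<inter> B) \<le> h * b"
      "\<And>u v. u \<in> A - B \<Longrightarrow> v \<in> B - A \<Longrightarrow> \<not> E u v" for A B
  proof (rule ccontr)
    assume "\<not> ?thesis"
    then have "card P \<le> 3 * card A" "card P \<le> 3 * card B" by auto
    from that this have thesis by (rule good)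
    with no show False ..
  qed
  with assms show False by (rule separator_contradiction)
qed

section \<open>Planar graphs have no \<open>K\<^sub>6\<close> minor\<close>

text \<open>\<open>V\<close> is whichever of the inside and the outside does not contain
  \<open>x\<close>. Seen from \<open>x\<close>, the two play symmetric roles and need not be told
  apart.\<close>

lemma Jordan_other_side:
  fixes c :: "real \<Rightarrow> complex"
  assumes c: "simple_path c" "pathfinish c = pathstart c" and x: "x \<notin> path_image c"
  defines "V \<equiv> {v. v \<notin> path_image c \<and> \<not> connected_component (- path_image c) x v}"
  shows "V \<noteq> {}" "connected V" "frontier V = path_image c"
proof -
  let ?J = "path_image c"
  have J: "inside ?J \<noteq> {}" "open (inside ?J)" "connected (inside ?J)"
    "outside ?J \<noteq> {}" "open (outside ?J)" "connected (outside ?J)"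
    "inside ?J \<inter> outside ?J = {}" "inside ?J \<union> outside ?J = - ?J"
    "frontier (inside ?J) = ?J" "frontier (outside ?J) = ?J"
    using Jordan_inside_outside[OF c] by auto
  have V_eq: "V = O'" if "x \<in> I" and I: "open I" "connected I" "open O'"
      "I \<inter> O' = {}" "I \<union> O' = - ?J" for I O'
  proof -
    have "connected_component (- ?J) x v" if "v \<in> I" for v
      using that I \<open>x \<in> I\<close> by (auto intro!: connected_componentI[of I])
    moreover have "\<not> connected_component (- ?J) x v" if v: "v \<in> O'" for v
    proof
      assume "connected_component (- ?J) x v"
      then obtain T where "connected T" "T \<subseteq> - ?J" "x \<in> T" "v \<in> T"
        by (auto simp: connected_component_def)
      then show False using connectedD[of T I O'] I \<open>x \<in> I\<close> v by blast
    qed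
    ultimately show ?thesis using I unfolding V_def by blast
  qed
  have "V = outside ?J \<or> V = inside ?J"
    using V_eq[of "inside ?J" "outside ?J"] V_eq[of "outside ?J" "inside ?J"] J x by blast
  then show "V \<noteq> {}" "connected V" "frontier V = ?J" using J by auto
qed

text \<open>
  The side of each cycle \<open>J k\<close> that avoids \<open>x\<close> is a face of the theta graph. By Janiszewski's
  theorem two of these three faces coincide, although they have different boundaries.
\<close>

lemma theta_not_accessible:
  fixes c :: "nat \<Rightarrow> real \<Rightarrow> complex"
  assumes arcs: "\<And>i. i < 3 \<Longrightarrow> arc (c i) \<and> pathstart (c i) = a \<and> pathfinish (c i) = b"
    and disj: "\<And>i j. i < 3 \<Longrightarrow> j < 3 \<Longrightarrow> i \<noteq> j \<Longrightarrow> path_image (c i) \<inter> path_image (c j) = {a, b}"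
    and Q: "\<And>i. i < 3 \<Longrightarrow> connected (Q i) \<and> x \<in> Q i \<and> Q i \<inter> path_image (c i) \<noteq> {}"
    and Q_disj: "\<And>i j. i < 3 \<Longrightarrow> j < 3 \<Longrightarrow> i \<noteq> j \<Longrightarrow> Q i \<inter> path_image (c j) = {}"
  shows False
proof -
  define I where "I i = path_image (c i)" for i
  define J where "J k = (\<Union>i\<in>{..<3} - {k}. I i)" for k
  define V where "V k = {v. v \<notin> J k \<and> \<not> connected_component (- J k) x v}" for k
  have ab: "a \<in> I i" "b \<in> I i" if "i < 3" for i
    using arcs[OF that] unfolding I_def by auto
  have other: "\<exists>i j. i < 3 \<and> j < 3 \<and> i \<noteq> j \<and> i \<noteq> k \<and> j \<noteq> k \<and> {..<3} - {k} = {i, j}"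
    if k: "k < 3" for k :: nat
  proof -
    have "k = 0 \<or> k = 1 \<or> k = 2" using k by auto
    moreover have "{..<3} - {0} = {1, 2::nat}" "{..<3} - {1} = {0, 2::nat}"
      "{..<3} - {2} = {0, 1::nat}"
      by auto
    moreover have "(1::nat) < 3 \<and> (2::nat) < 3 \<and> (0::nat) < 3 \<and>
        (0::nat) \<noteq> 1 \<and> (0::nat) \<noteq> 2 \<and> (1::nat) \<noteq> 2"
      by auto
    ultimately show ?thesis by metis
  qed
  have x: "x \<notin> I i" if i: "i < 3" for i
  proof -
    obtain j where "j < 3" "j \<noteq> i" using other[OF i] by blast
    then show ?thesis using Q[of j] Q_disj[of j i] i unfolding I_def by blast
  qed
  have V: "V k \<noteq> {} \<and> connected (V k) \<and> frontier (V k) = J k" if k: "k < 3" for k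
  proof -
    obtain i j where ij: "i < 3" "j < 3" "i \<noteq> j" "{..<3} - {k} = {i, j}"
      using other[OF k] by blast
    let ?g = "c i +++ reversepath (c j)"
    have ends: "pathstart (c i) = a" "pathfinish (c i) = b" "pathstart (c j) = a" "pathfinish (c j) = b"
      using arcs ij by auto
    have g: "path_image ?g = J k"
      using ij(4) ends by (auto simp: J_def I_def path_image_join)
    have "simple_path ?g"
      using arcs ij disj[of i j] ends
      by (intro simple_path_join_loop) (auto simp: arc_reversepath)
    moreover have "pathfinish ?g = pathstart ?g" using ends by simp
    moreover have "x \<notin> path_image ?g" using x g ij by (auto simp: J_def)
    ultimately show ?thesis using Jordan_other_side[of ?g x] unfolding g V_def by blast
  qed
  have QJ: "Q k \<inter> J k = {}" if "k < 3" for k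
    using Q_disj that by (auto simp: J_def I_def)
  \<comment> \<open>\<open>Q k\<close> joins \<open>x\<close> to the inner part of the arc
    \<open>I k\<close> away from the cycle \<open>J k\<close>, so this arc lies on the side of
    \<open>x\<close>. Hence \<open>V k\<close> avoids the whole theta graph, not only its own
    cycle.\<close>
  have V_I: "V k \<inter> I l = {}" if "k < 3" "l < 3" for k l
  proof (cases "l = k")
    case False
    then show ?thesis using that by (auto simp: V_def J_def)
  next
    case True
    have "connected (I k - {a, b})"
      using connected_simple_path_endless[of "c k"] arcs[OF \<open>k < 3\<close>] arc_imp_simple_path
      by (auto simp: I_def)
    moreover have "Q k \<inter> {a, b} = {}"
      using other[OF \<open>k < 3\<close>] ab Q_disj[OF \<open>k < 3\<close>] I_def by blast
    ultimately have con: "connected (Q k \<union> (I k - {a, b}))"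
      using Q[OF \<open>k < 3\<close>] by (intro connected_Un) (auto simp: I_def)
    have "(I k - {a, b}) \<inter> J k = {}"
      using disj \<open>k < 3\<close> unfolding J_def I_def by blast
    then have sub: "Q k \<union> (I k - {a, b}) \<subseteq> - J k" using QJ[OF \<open>k < 3\<close>] by blast
    have "v \<notin> V k" if "v \<in> I k" for v
    proof
      assume v: "v \<in> V k"
      obtain i where "i < 3" "i \<noteq> k" using other[OF \<open>k < 3\<close>] by blast
      then have "a \<in> J k" "b \<in> J k" using ab[of i] by (auto simp: J_def)
      then have "v \<in> I k - {a, b}" using v that by (auto simp: V_def)
      then have "connected_component (- J k) x v"
        using con sub Q[OF \<open>k < 3\<close>] by (intro connected_componentI[OF con sub]) auto
      then show False using v by (simp add: V_def)
    qed
    then show ?thesis using True by blast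
  qed
  have V_J: "V k \<inter> J l = {}" if "k < 3" "l < 3" for k l
    using V_I that by (auto simp: J_def)
  \<comment> \<open>If two sides meet, neither crosses the frontier of the other, so they are equal
    and have the same frontier. But \<open>Q l\<close> touches \<open>I l\<close>, which is part of
    \<open>J k\<close>, and avoids \<open>J l\<close>.\<close>
  have V_V: False if k: "k < 3" "l < 3" "k \<noteq> l" and v: "v \<in> V k" "v \<in> V l" for k l v
  proof -
    have sub: "V k \<subseteq> V l" if "k < 3" "l < 3" "v \<in> V k" "v \<in> V l" for k l
    proof (rule ccontr)
      assume "\<not> V k \<subseteq> V l"
      then have "V k \<inter> frontier (V l) \<noteq> {}"
        using that V by (intro connected_Int_frontier) auto
      then show False using V V_J that by auto
    qed
    have "V k = V l" using sub[of k l] sub[of l k] k v by blast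
    then have "J k = J l" using V k by metis
    moreover obtain q where q: "q \<in> Q l" "q \<in> I l" using Q[OF k(2)] by (auto simp: I_def)
    then have "q \<in> J k" using k by (auto simp: J_def)
    ultimately show False using QJ[OF k(2)] q by blast
  qed
  \<comment> \<open>\<open>J 2\<close> separates \<open>v\<close> from \<open>x\<close>, hence so
    does \<open>J 0 \<union> J 1\<close>, the whole theta graph. As \<open>J 0\<close> and
    \<open>J 1\<close> meet in the connected arc \<open>I 2\<close>, one of them separates the two
    points by itself.\<close>
  obtain v where v: "v \<in> V 2" using V[of 2] by auto
  have "\<not> connected_component (- (J 0 \<union> J 1)) x v"
  proof
    assume "connected_component (- (J 0 \<union> J 1)) x v"
    moreover have "- (J 0 \<union> J 1) \<subseteq> - J 2" by (auto simp: J_def)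
    ultimately have "connected_component (- J 2) x v" by (rule connected_component_of_subset)
    then show False using v by (simp add: V_def)
  qed
  moreover have compact_I: "compact (I i)" if "i < 3" for i
    using arcs[OF that] by (auto simp: I_def arc_imp_path compact_path_image)
  have "compact (J 0)" "closed (J 1)"
    unfolding J_def by (auto intro!: compact_UN compact_imp_closed compact_I)
  moreover have "J 0 \<inter> J 1 = I 2"
  proof -
    have "{..<3} - {0} = {1, 2::nat}" "{..<3} - {1} = {0, 2::nat}" by auto
    then have "J 0 = I 1 \<union> I 2" "J 1 = I 0 \<union> I 2" by (auto simp: J_def)
    moreover have "I 1 \<inter> I 0 = {a, b}" using disj[of 1 0] by (simp add: I_def)
    ultimately show ?thesis using ab[of 2] by auto
  qed
  moreover have "connected (I 2)"
    using arcs[of 2] by (simp add: I_def arc_imp_path connected_path_image)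
  ultimately have "\<not> connected_component (- J 0) x v \<or> \<not> connected_component (- J 1) x v"
    using Janiszewski[of "J 0" "J 1" x v] by auto
  moreover have "v \<notin> J 0" "v \<notin> J 1" using V_J[of 2 0] V_J[of 2 1] v by auto
  ultimately have "v \<in> V 0 \<or> v \<in> V 1" by (auto simp: V_def)
  then show False using V_V[of 2 0 v] V_V[of 2 1 v] v by auto
qed

text \<open>An arc \<open>h\<close> from \<open>p 2\<close> is led to an arc \<open>g\<close> from
  \<open>p 0\<close> to \<open>p 1\<close>; cutting \<open>h\<close> at its first point on
  \<open>g\<close> gives the centre \<open>w\<close>.\<close>

lemma tripod:
  fixes K :: "complex set" and p :: "nat \<Rightarrow> complex"
  assumes K: "\<And>i. i < 3 \<Longrightarrow> path_connected (insert (p i) K)" "K \<noteq> {}"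
    and p: "\<And>i. i < 3 \<Longrightarrow> p i \<notin> K" "inj_on p {..<3}"
  obtains w c where "w \<in> K"
    "\<And>i. i < 3 \<Longrightarrow> arc (c i) \<and> pathstart (c i) = w \<and> pathfinish (c i) = p i \<and>
      path_image (c i) \<subseteq> insert (p i) K"
    "\<And>i j. i < 3 \<Longrightarrow> j < 3 \<Longrightarrow> i \<noteq> j \<Longrightarrow> path_image (c i) \<inter> path_image (c j) = {w}"
proof -
  have p_ne: "p 0 \<noteq> p 1" "p 0 \<noteq> p 2" "p 1 \<noteq> p 2"
    using inj_onD[OF p(2), of 0 1] inj_onD[OF p(2), of 0 2] inj_onD[OF p(2), of 1 2] by auto
  have pK: "p 0 \<notin> K" "p 1 \<notin> K" "p 2 \<notin> K" using p(1) by auto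
  have "path_connected (insert (p 0) K \<union> insert (p 1) K)"
    using K by (intro path_connected_Un) auto
  then obtain g where g: "arc g" "path_image g \<subseteq> insert (p 0) K \<union> insert (p 1) K"
    "pathstart g = p 0" "pathfinish g = p 1"
    using p_ne unfolding path_connected_arcwise by blast
  have g_inj: "inj_on g {0..1}" using g(1) by (simp add: arc_def)
  have g01: "g 0 = p 0" "g 1 = p 1" using g by (auto simp: pathstart_def pathfinish_def)
  have p2g: "p 2 \<notin> path_image g" using g(2) p_ne pK by auto
  have gK: "g t \<in> K" if "0 < t" "t < 1" for t
  proof -
    have "g t \<noteq> g 0" "g t \<noteq> g 1" using inj_onD[OF g_inj, of t] that by auto
    moreover have "g t \<in> path_image g" using that by (auto simp: path_image_def)
    ultimately show ?thesis using g(2) g01 by auto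
  qed
  \<comment> \<open>Any inner point of \<open>g\<close> would serve as the target; it lies in
    \<open>K\<close> because an arc visits its ends only once.\<close>
  have "g (1/2) \<in> insert (p 2) K" "p 2 \<in> insert (p 2) K" "g (1/2) \<noteq> p 2" using gK[of "1/2"] pK by auto
  then obtain h where h: "arc h" "path_image h \<subseteq> insert (p 2) K" "pathstart h = p 2"
    "pathfinish h = g (1/2)"
    using K(1)[of 2] unfolding path_connected_arcwise by (metis lessI numeral_2_eq_2 numeral_3_eq_3)
  have h_inj: "inj_on h {0..1}" and h_cont: "continuous_on {0..1} h"
    using h(1) by (auto simp: arc_def path_def)
  have h01: "h 0 = p 2" "h 1 = g (1/2)" using h by (auto simp: pathstart_def pathfinish_def)
  let ?H = "{0..1} \<inter> h -` path_image g"
  have "closed (path_image g)" using g(1) by (simp add: arc_imp_path closed_path_image)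
  then have "closed ?H" using h_cont by (intro continuous_closed_preimage) auto
  then have "compact ({0..1} \<inter> ?H)" by (intro compact_Int_closed) auto
  then have "compact ?H" by (simp add: Int_left_absorb)
  moreover have "1 \<in> ?H" using h01 by (auto simp: path_image_def)
  ultimately obtain u where u: "u \<in> ?H" and u_min: "\<And>t. t \<in> ?H \<Longrightarrow> u \<le> t"
    using compact_attains_inf[of ?H] by blast
  have "u \<noteq> 0" using u h01 p2g by auto
  then have u01: "0 < u" "u \<le> 1" using u by auto
  define w where "w = h u"
  obtain t where t: "w = g t" "0 \<le> t" "t \<le> 1" using u by (auto simp: w_def path_image_def)
  have wK: "w \<in> K"
  proof -
    have "w \<in> path_image h" using u by (auto simp: w_def path_image_def)
    moreover have "w \<noteq> p 2" using u p2g by (auto simp: w_def)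
    ultimately show ?thesis using h(2) by auto
  qed
  then have t01: "0 < t" "t < 1" using t g01 pK by (auto simp: less_le)
  define c where "c i = (if i = 0 then subpath t 0 g else if i = 1 then subpath t 1 g
    else subpath u 0 h)" for i :: nat
  have c_img: "path_image (c 0) = g ` {0..t}" "path_image (c 1) = g ` {t..1}"
    "path_image (c 2) = h ` {0..u}"
    using t01 u01 by (auto simp: c_def path_image_subpath)
  have three: "i = 0 \<or> i = 1 \<or> i = 2" if "i < 3" for i :: nat using that by auto
  have c01: "path_image (c 0) \<inter> path_image (c 1) = {w}"
  proof -
    have "g ` {0..t} \<inter> g ` {t..1} = g ` ({0..t} \<inter> {t..1})"
      using t01 by (intro inj_on_image_Int[OF g_inj, symmetric]) auto
    also have "{0..t} \<inter> {t..1} = {t}" using t01 by auto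
    finally show ?thesis unfolding c_img using t by simp
  qed
  have "h s \<notin> path_image g" if "0 \<le> s" "s < u" for s
    using u_min[of s] that u01 by auto
  then have h_g: "h ` {0..u} \<inter> path_image g \<subseteq> {w}"
    unfolding w_def by (force simp: less_le)
  have g_sub: "g ` {0..t} \<subseteq> path_image g" "g ` {t..1} \<subseteq> path_image g"
    using t01 by (auto simp: path_image_def)
  have c2: "path_image (c 0) \<inter> path_image (c 2) = {w}" "path_image (c 1) \<inter> path_image (c 2) = {w}"
  proof -
    have "h u \<in> h ` {0..u}" "g t \<in> g ` {0..t}" "g t \<in> g ` {t..1}"
      using t01 u01 by simp_all
    then have "w \<in> h ` {0..u}" "w \<in> g ` {0..t}" "w \<in> g ` {t..1}"
      using t(1) by (simp_all only: w_def)
    then show "path_image (c 0) \<inter> path_image (c 2) = {w}" "path_image (c 1) \<inter> path_image (c 2) = {w}"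
      using h_g g_sub unfolding c_img by blast+
  qed
  show ?thesis
  proof (rule that[OF wK, of c])
    fix i j :: nat assume "i < 3" "j < 3" "i \<noteq> j"
    with c01 c2 show "path_image (c i) \<inter> path_image (c j) = {w}"
      using three[OF \<open>i < 3\<close>] three[OF \<open>j < 3\<close>] by (elim disjE) (auto simp: Int_commute)
  next
    fix i :: nat assume "i < 3"
    have "g ` {0..t} \<subseteq> insert (p 0) K" "g ` {t..1} \<subseteq> insert (p 1) K"
    proof -
      have "g s = p 0 \<or> g s \<in> K" if "0 \<le> s" "s \<le> t" for s
        using gK[of s] g01 t01 that by (cases "s = 0") auto
      moreover have "g s = p 1 \<or> g s \<in> K" if "t \<le> s" "s \<le> 1" for s
        using gK[of s] g01(2) t01 that by (cases "s = 1") auto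
      ultimately show "g ` {0..t} \<subseteq> insert (p 0) K" "g ` {t..1} \<subseteq> insert (p 1) K"
        by (simp_all add: image_subset_iff)
    qed
    moreover have "h ` {0..u} \<subseteq> insert (p 2) K" using h(2) u01 by (force simp: path_image_def)
    moreover have "arc (c 0)" "arc (c 1)" "arc (c 2)"
      using t01 u01 g h by (auto simp: c_def intro!: arc_subpath_arc)
    moreover have "pathstart (c 0) = w" "pathstart (c 1) = w" "pathstart (c 2) = w"
      "pathfinish (c 0) = p 0" "pathfinish (c 1) = p 1" "pathfinish (c 2) = p 2"
      using t g01 h01 by (auto simp: c_def w_def)
    ultimately show "arc (c i) \<and> pathstart (c i) = w \<and> pathfinish (c i) = p i \<and>
        path_image (c i) \<subseteq> insert (p i) K"
      using three[OF \<open>i < 3\<close>] c_img by (elim disjE) simp_all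
  qed
qed

section \<open>Drawings of \<open>K_{3,3}\<close>\<close>

lemma path_connected_Un_path:
  assumes "path_connected S" "path g" "T \<subseteq> {0..1}" "convex T" "e \<in> T" "g e \<in> S"
  shows "path_connected (S \<union> g ` T)"
proof -
  have "continuous_on T g" using assms(2,3) by (auto simp: path_def intro: continuous_on_subset)
  then have "path_connected (g ` T)"
    using assms(4) by (intro path_connected_continuous_image convex_imp_path_connected)
  then show ?thesis using assms by (intro path_connected_Un) auto
qed

text \<open>The vertices are blown up to path-connected sets, so that the branch sets of a minor fit
  without contraction. Tripods around \<open>A 0\<close> and \<open>A 1\<close>, linked through the
  sets \<open>B j\<close>, form a theta graph with three arcs from \<open>w 0\<close> to
  \<open>w 1\<close>. From \<open>A 2\<close> the \<open>j\<close>-th arc is reached along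
  \<open>g 2 j\<close> without touching the other two, which \<open>theta_not_accessible\<close>
  forbids.\<close>

lemma not_planar_K33:
  fixes A B :: "nat \<Rightarrow> complex set" and g :: "nat \<Rightarrow> nat \<Rightarrow> real \<Rightarrow> complex"
  assumes A: "\<And>i. i < 3 \<Longrightarrow> path_connected (A i)" and B: "\<And>i. i < 3 \<Longrightarrow> path_connected (B i)"
    and AB: "\<And>i j. i < 3 \<Longrightarrow> j < 3 \<Longrightarrow> A i \<inter> B j = {}"
    and AA: "\<And>i j. i < 3 \<Longrightarrow> j < 3 \<Longrightarrow> i \<noteq> j \<Longrightarrow> A i \<inter> A j = {}"
    and BB: "\<And>i j. i < 3 \<Longrightarrow> j < 3 \<Longrightarrow> i \<noteq> j \<Longrightarrow> B i \<inter> B j = {}"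
    and g: "\<And>i j. i < 3 \<Longrightarrow> j < 3 \<Longrightarrow> arc (g i j) \<and> g i j 0 \<in> A i \<and> g i j 1 \<in> B j"
    and gAB: "\<And>i j k s. i < 3 \<Longrightarrow> j < 3 \<Longrightarrow> k < 3 \<Longrightarrow> 0 < s \<Longrightarrow> s < 1 \<Longrightarrow>
      g i j s \<notin> A k \<and> g i j s \<notin> B k"
    and gg: "\<And>i j i' j' s t. i < 3 \<Longrightarrow> j < 3 \<Longrightarrow> i' < 3 \<Longrightarrow> j' < 3 \<Longrightarrow> 0 < s \<Longrightarrow> s < 1 \<Longrightarrow>
      0 < t \<Longrightarrow> t < 1 \<Longrightarrow> g i j s = g i' j' t \<Longrightarrow> i = i' \<and> j = j'"
  shows False
proof -
  define R where "R z q \<longleftrightarrow> (\<exists>i<3. z \<in> A i \<and> q = (0::nat, i, 0::nat, 0::real)) \<or>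
    (\<exists>j<3. z \<in> B j \<and> q = (1, j, 0, 0)) \<or>
    (\<exists>i<3. \<exists>j<3. \<exists>s. 0 < s \<and> s < 1 \<and> z = g i j s \<and> q = (2, i, j, s))" for z q
  have g_inj: "s = t" if "i < 3" "j < 3" "0 < s" "s < 1" "0 < t" "t < 1" "g i j s = g i j t" for i j s t
    using g[OF that(1,2)] that(3-) inj_onD[of "g i j" "{0..1}" s t] by (auto simp: arc_def)
  have R_unique: "q = q'" if q: "R z q" and q': "R z q'" for z q q'
    using q unfolding R_def
  proof (elim disjE exE conjE)
    fix i assume i: "i < 3" "z \<in> A i" "q = (0, i, 0, 0)"
    show ?thesis using q' unfolding R_def
    proof (elim disjE exE conjE)
      show ?thesis if "i' < 3" "z \<in> A i'" "q' = (0, i', 0, 0)" for i'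
        using AA[of i i'] i that by blast
      show ?thesis if "j < 3" "z \<in> B j" for j using AB[of i j] i that by blast
      show ?thesis if "i' < 3" "j < 3" "0 < s" "s < 1" "z = g i' j s" for i' j s
        using gAB[of i' j i s] i that by blast
    qed
  next
    fix i assume i: "i < 3" "z \<in> B i" "q = (1, i, 0, 0)"
    show ?thesis using q' unfolding R_def
    proof (elim disjE exE conjE)
      show ?thesis if "j < 3" "z \<in> A j" for j using AB[of j i] i that by blast
      show ?thesis if "i' < 3" "z \<in> B i'" "q' = (1, i', 0, 0)" for i'
        using BB[of i i'] i that by blast
      show ?thesis if "i' < 3" "j < 3" "0 < s" "s < 1" "z = g i' j s" for i' j s
        using gAB[of i' j i s] i that by blast
    qed
  next
    fix i j s assume i: "i < 3" "j < 3" "0 < s" "s < 1" "z = g i j s" "q = (2, i, j, s)"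
    show ?thesis using q' unfolding R_def
    proof (elim disjE exE conjE)
      show ?thesis if "i' < 3" "z \<in> A i'" for i' using gAB[of i j i' s] i that by blast
      show ?thesis if "i' < 3" "z \<in> B i'" for i' using gAB[of i j i' s] i that by blast
      show ?thesis if t: "i' < 3" "j' < 3" "0 < t" "t < 1" "z = g i' j' t" "q' = (2, i', j', t)"
        for i' j' t
      proof -
        have "i = i' \<and> j = j'" using gg[of i j i' j' s t] i t by simp
        then show ?thesis using g_inj[of i j s t] i t by simp
      qed
    qed
  qed
  \<comment> \<open>\<open>F z\<close> tells which part of the drawing contains \<open>z\<close>: some \<open>A i\<close> (tag 0), some \<open>B j\<close> (tag 1),
    or the interior of \<open>g i j\<close> at parameter \<open>s\<close> (tag 2). Disjointness of subsets is read off from \<open>F\<close>.\<close>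
  define F where "F z = (THE q. R z q)" for z
  have F: "F z = q" if "R z q" for z q
    unfolding F_def using that R_unique by blast
  have FA: "F z = (0, i, 0, 0)" if "i < 3" "z \<in> A i" for z i
    by (rule F) (use that in \<open>auto simp: R_def\<close>)
  have FB: "F z = (1, j, 0, 0)" if "j < 3" "z \<in> B j" for z j
    by (rule F) (use that in \<open>auto simp: R_def\<close>)
  have Fg: "F (g i j s) = (2, i, j, s)" if "i < 3" "j < 3" "0 < s" "s < 1" for i j s
    by (rule F) (use that in \<open>auto simp: R_def\<close>)

  define m where "m i j = g i j (1/2)" for i j
  \<comment> \<open>The edges are cut at their midpoints. \<open>m i j\<close> stays outside
    \<open>KA i\<close>, where it is an end of a tripod, and for \<open>i < 2\<close> it lies in
    \<open>KB j\<close>, where the two tripods are linked. The arcs \<open>g 2 j\<close> are left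
    out of \<open>KB j\<close>; they belong to the approach \<open>Q j\<close> from
    \<open>A 2\<close>.\<close>
  define KA where "KA i = A i \<union> g i 0 ` {0..<1/2} \<union> g i 1 ` {0..<1/2} \<union> g i 2 ` {0..<1/2}" for i
  define KB where "KB j = B j \<union> g 0 j ` {1/2..1} \<union> g 1 j ` {1/2..1}" for j
  have Fm: "F (m i j) = (2, i, j, 1/2)" if "i < 3" "j < 3" for i j
    using Fg[OF that, of "1/2"] by (simp add: m_def)
  have F_low: "F (g i j s) = (0, i, 0, 0) \<or> F (g i j s) = (2, i, j, s)"
    if "i < 3" "j < 3" "0 \<le> s" "s < 1" for i j s
    using Fg[OF that(1,2), of s] FA[OF that(1), of "g i j s"] g[OF that(1,2)] that
    by (cases "s = 0") auto
  have F_high: "F (g i j s) = (1, j, 0, 0) \<or> F (g i j s) = (2, i, j, s)"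
    if "i < 3" "j < 3" "0 < s" "s \<le> 1" for i j s
    using Fg[OF that(1,2), of s] FB[OF that(2), of "g i j s"] g[OF that(1,2)] that
    by (cases "s = 1") auto
  have FKA: "F z = (0, i, 0, 0) \<or> (\<exists>j s. F z = (2, i, j, s) \<and> s < 1/2)"
    if i: "i < 3" and z: "z \<in> KA i" for i z
  proof -
    have step: ?thesis if "j < 3" and zj: "z \<in> g i j ` {0..<1/2}" for j
    proof -
      obtain s where "0 \<le> s" "s < 1/2" "z = g i j s" using zj by auto
      then show ?thesis using F_low[OF i \<open>j < 3\<close>, of s] by auto
    qed
    consider "z \<in> A i" | "z \<in> g i 0 ` {0..<1/2}" | "z \<in> g i 1 ` {0..<1/2}" | "z \<in> g i 2 ` {0..<1/2}"
      using z unfolding KA_def by blast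
    then show ?thesis
    proof cases
      case 1
      then show ?thesis using FA[OF i] by simp
    next
      case 2
      then show ?thesis by (intro step[of 0]) auto
    next
      case 3
      then show ?thesis by (intro step[of 1]) auto
    next
      case 4
      then show ?thesis by (intro step[of 2]) auto
    qed
  qed
  have FKB: "F z = (1, j, 0, 0) \<or> (\<exists>i s. F z = (2, i, j, s) \<and> 1/2 \<le> s \<and> i < 2)"
    if j: "j < 3" and z: "z \<in> KB j" for j z
  proof -
    have step: ?thesis if i: "i < 2" and zi: "z \<in> g i j ` {1/2..1}" for i
    proof -
      obtain s where "1/2 \<le> s" "s \<le> 1" "z = g i j s" using zi by auto
      then show ?thesis using F_high[OF _ j, of i s] i by auto
    qed
    consider "z \<in> B j" | "z \<in> g 0 j ` {1/2..1}" | "z \<in> g 1 j ` {1/2..1}"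
      using z unfolding KB_def by blast
    then show ?thesis
    proof cases
      case 1
      then show ?thesis using FB[OF j] by simp
    next
      case 2
      then show ?thesis by (intro step[of 0]) auto
    next
      case 3
      then show ?thesis by (intro step[of 1]) auto
    qed
  qed
  have KA_KB: "KA i \<inter> KB j = {}" if "i < 3" "j < 3" for i j
    using FKA[OF that(1)] FKB[OF that(2)] by fastforce
  have KA_KA: "KA i \<inter> KA j = {}" if "i < 3" "j < 3" "i \<noteq> j" for i j
    using FKA[OF that(1)] FKA[OF that(2)] that(3) by fastforce
  have KB_KB: "KB i \<inter> KB j = {}" if "i < 3" "j < 3" "i \<noteq> j" for i j
    using FKB[OF that(1)] FKB[OF that(2)] that(3) by fastforce
  have m_KA: "m i j \<notin> KA k" if "i < 3" "j < 3" "k < 3" for i j k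
    using FKA[OF that(3), of "m i j"] Fm[OF that(1,2)] by auto
  have m_KB: "j = k" if "i < 3" "j < 3" "k < 3" "m i j \<in> KB k" for i j k
    using FKB[OF that(3,4)] Fm[OF that(1,2)] by auto
  have m_inj: "i = i' \<and> j = j'" if "i < 3" "j < 3" "i' < 3" "j' < 3" "m i j = m i' j'" for i j i' j'
    using Fm[OF that(1,2)] Fm[OF that(3,4)] unfolding that(5) by simp
  have g_path: "path (g i j)" if "i < 3" "j < 3" for i j using g[OF that] arc_imp_path by blast

  have pcKA: "path_connected (insert (m i j) (KA i))" if i: "i < 3" and j: "j < 3" for i j
  proof -
    have "path_connected (KA i)"
      unfolding KA_def using g[OF i] A[OF i] g_path[OF i]
      by (intro path_connected_Un_path[where e = 0]) auto
    then have "path_connected (KA i \<union> g i j ` {0..1/2})"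
      using g[OF i j] g_path[OF i j] by (intro path_connected_Un_path[where e = 0]) (auto simp: KA_def)
    moreover have "g i j ` {0..<1/2} \<subseteq> KA i"
    proof -
      have "j = 0 \<or> j = 1 \<or> j = 2" using j by auto
      then show ?thesis unfolding KA_def by auto
    qed
    moreover have "{0..1/2} = insert (1/2) {0..<1/2::real}" by auto
    ultimately show ?thesis by (simp add: m_def Un_absorb2)
  qed
  have KA_ne: "KA i \<noteq> {}" if "i < 3" for i using g[OF that, of 0] by (auto simp: KA_def)
  have "\<exists>w c. w \<in> KA i \<and> (\<forall>j<3. arc (c j) \<and> pathstart (c j) = w \<and> pathfinish (c j) = m i j \<and>
      path_image (c j) \<subseteq> insert (m i j) (KA i)) \<and>
      (\<forall>j<3. \<forall>k<3. j \<noteq> k \<longrightarrow> path_image (c j) \<inter> path_image (c k) = {w})" if i: "i < 3" for i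
  proof -
    have "inj_on (m i) {..<3}" using m_inj[OF i _ i] by (auto simp: inj_on_def)
    then obtain w c where "w \<in> KA i"
      "\<And>j. j < 3 \<Longrightarrow> arc (c j) \<and> pathstart (c j) = w \<and> pathfinish (c j) = m i j \<and>
      path_image (c j) \<subseteq> insert (m i j) (KA i)"
      "\<And>j k. j < 3 \<Longrightarrow> k < 3 \<Longrightarrow> j \<noteq> k \<Longrightarrow> path_image (c j) \<inter> path_image (c k) = {w}"
      using tripod[of "m i" "KA i"] pcKA[OF i] KA_ne[OF i] m_KA[OF i _ i] by blast
    then show ?thesis by blast
  qed
  then obtain w t where w: "\<And>i. i < 3 \<Longrightarrow> w i \<in> KA i"
    and t: "\<And>i j. i < 3 \<Longrightarrow> j < 3 \<Longrightarrow> arc (t i j) \<and> pathstart (t i j) = w i \<and>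
      pathfinish (t i j) = m i j \<and> path_image (t i j) \<subseteq> insert (m i j) (KA i)"
    and tt: "\<And>i j k. i < 3 \<Longrightarrow> j < 3 \<Longrightarrow> k < 3 \<Longrightarrow> j \<noteq> k \<Longrightarrow>
      path_image (t i j) \<inter> path_image (t i k) = {w i}"
    by metis
  have pcKB: "path_connected (KB j)" if j: "j < 3" for j
    unfolding KB_def using g[OF _ j] B[OF j] g_path[OF _ j]
    by (intro path_connected_Un_path[where e = 1]) auto
  have mKB: "m 0 j \<in> KB j" "m 1 j \<in> KB j" for j by (auto simp: KB_def m_def)
  have "\<exists>\<beta>. arc \<beta> \<and> pathstart \<beta> = m 0 j \<and> pathfinish \<beta> = m 1 j \<and> path_image \<beta> \<subseteq> KB j"
    if j: "j < 3" for j
  proof -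
    have "m 0 j \<noteq> m 1 j" using m_inj[of 0 j 1 j] j by auto
    then show ?thesis using pcKB[OF j] mKB[of j] unfolding path_connected_arcwise by blast
  qed
  then obtain \<beta> where \<beta>: "\<And>j. j < 3 \<Longrightarrow> arc (\<beta> j) \<and> pathstart (\<beta> j) = m 0 j \<and>
    pathfinish (\<beta> j) = m 1 j \<and> path_image (\<beta> j) \<subseteq> KB j" by metis
  define c where "c j = t 0 j +++ \<beta> j +++ reversepath (t 1 j)" for j
  have img: "path_image (c j) = path_image (t 0 j) \<union> path_image (\<beta> j) \<union> path_image (t 1 j)"
    if "j < 3" for j
    using t[of 0 j] t[of 1 j] \<beta>[of j] that by (auto simp: c_def path_image_join)
  have t_sub: "path_image (t i j) \<subseteq> insert (m i j) (KA i)" if "i < 3" "j < 3" for i j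
    using t[OF that] by blast
  have \<beta>_sub: "path_image (\<beta> j) \<subseteq> KB j" if "j < 3" for j using \<beta>[OF that] by blast
  have t0t1: "path_image (t 0 j) \<inter> path_image (t 1 k) = {}" if "j < 3" "k < 3" for j k
    using t_sub[of 0 j] t_sub[of 1 k] KA_KA[of 0 1] m_KA[of 0 j 1] m_KA[of 1 k 0] m_inj[of 0 j 1 k] that
    by auto
  have t_\<beta>: "path_image (t i j) \<inter> path_image (\<beta> j) \<subseteq> {m i j}" if "i < 3" "j < 3" for i j
    using t_sub[OF that] \<beta>_sub[OF that(2)] KA_KB[OF that] by blast
  have t_\<beta>': "path_image (t i j) \<inter> path_image (\<beta> k) = {}" if "i < 3" "j < 3" "k < 3" "j \<noteq> k" for i j k
    using t_sub[OF that(1,2)] \<beta>_sub[OF that(3)] KA_KB[OF that(1,3)] m_KB[OF that(1-3)] that(4) by blast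
  have \<beta>\<beta>: "path_image (\<beta> j) \<inter> path_image (\<beta> k) = {}" if "j < 3" "k < 3" "j \<noteq> k" for j k
    using \<beta>_sub[OF that(1)] \<beta>_sub[OF that(2)] KB_KB[OF that] by blast
  define Q where "Q j = A 2 \<union> g 2 j ` {0..1} \<union> KB j" for j
  have FQ: "F z = (0, 2, 0, 0) \<or> (\<exists>s. F z = (2, 2, j, s)) \<or> z \<in> KB j" 
    if j: "j < 3" and z: "z \<in> Q j" for j z
  proof (cases "z \<in> A 2 \<or> z \<in> KB j")
    case True
    then show ?thesis using FA[of 2 z] by auto
  next
    case False
    then obtain s where s: "0 \<le> s" "s \<le> 1" "z = g 2 j s" using z by (auto simp: Q_def)
    then show ?thesis
      using F_low[OF _ j, of 2 s] g[OF _ j, of 2] by (cases "s = 1") (auto simp: KB_def)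
  qed
  have Q_KA: "Q j \<inter> KA i = {}" if "j < 3" "i < 2" for i j
    using FQ[OF that(1)] FKA[of i] KA_KB[of i j] that by fastforce
  have Q_KB: "Q j \<inter> KB k = {}" if "j < 3" "k < 3" "j \<noteq> k" for j k
    using FQ[OF that(1)] FKB[OF that(2)] KB_KB[OF that] by fastforce
  have Q_m: "m i k \<notin> Q j" if "i < 2" "j < 3" "k < 3" "j \<noteq> k" for i j k
    using FQ[OF that(2), of "m i k"] Fm[of i k] m_KB[of i k j] that by auto
  obtain x where x: "x \<in> A 2" using g[of 2 0] by auto
  show False
  proof (rule theta_not_accessible[of c "w 0" "w 1" Q x])
    fix j :: nat assume j: "j < 3"
    have "arc (\<beta> j +++ reversepath (t 1 j))"
      using \<beta>[OF j] t[of 1 j] t_\<beta>[of 1 j] j by (intro arc_join) (auto simp: arc_reversepath)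
    moreover have "path_image (t 0 j) \<inter> path_image (\<beta> j +++ reversepath (t 1 j)) \<subseteq> {m 0 j}"
      using t_\<beta>[of 0 j] t0t1[of j j] \<beta>[OF j] t[of 1 j] j by (auto simp: path_image_join)
    ultimately show "arc (c j) \<and> pathstart (c j) = w 0 \<and> pathfinish (c j) = w 1"
      unfolding c_def using \<beta>[OF j] t[of 0 j] t[of 1 j] j by (auto intro!: arc_join)
    have g2: "g 2 j 0 \<in> A 2" "g 2 j 1 \<in> KB j" using g[of 2 j] j by (auto simp: KB_def)
    have "path_connected (A 2 \<union> g 2 j ` {0..1})"
      using A[of 2] g2(1) g_path[of 2 j] j by (intro path_connected_Un_path[where e = 0]) auto
    moreover have "(A 2 \<union> g 2 j ` {0..1}) \<inter> KB j \<noteq> {}"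
      using g2(2) by (auto intro!: image_eqI[of _ _ 1])
    ultimately have "path_connected (Q j)"
      unfolding Q_def using pcKB[OF j] by - (rule path_connected_Un)
    moreover have "m 0 j \<in> path_image (c j)"
      unfolding img[OF j] using t[of 0 j] pathfinish_in_path_image[of "t 0 j"] j by simp
    then have "Q j \<inter> path_image (c j) \<noteq> {}" using mKB(1)[of j] unfolding Q_def by blast
    ultimately show "connected (Q j) \<and> x \<in> Q j \<and> Q j \<inter> path_image (c j) \<noteq> {}"
      using x path_connected_imp_connected by (auto simp: Q_def)
  next
    fix j k :: nat assume jk: "j < 3" "k < 3" "j \<noteq> k"
    have [simp]: "(0::nat) < 3" "(1::nat) < 3" by auto
    have "path_image (t 1 j) \<inter> path_image (t 0 k) = {}" using t0t1[of k j] jk by blast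
    moreover have "path_image (\<beta> j) \<inter> path_image (t i k) = {}" if "i < 3" for i
      using t_\<beta>'[of i k j] jk that by blast
    ultimately show "path_image (c j) \<inter> path_image (c k) = {w 0, w 1}"
      unfolding img[OF jk(1)] img[OF jk(2)]
      using tt[of 0 j k] tt[of 1 j k] t0t1[of j k] t_\<beta>'[of 0 j k] t_\<beta>'[of 1 j k] \<beta>\<beta>[OF jk] jk
      by (auto simp: Int_Un_distrib Int_Un_distrib2)
    have "Q j \<inter> path_image (t i k) = {}" if "i < 2" for i
      using t_sub[of i k] Q_KA[of j i] Q_m[of i j k] that jk by auto
    moreover have "Q j \<inter> path_image (\<beta> k) = {}" using \<beta>_sub[of k] Q_KB[OF jk] jk by blast
    ultimately show "Q j \<inter> path_image (c k) = {}" unfolding img[OF jk(2)] by (simp add: Int_Un_distrib)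
  qed
qed

text \<open>Six branch sets form two triples with all nine connections between them, a drawing of
  \<open>K_{3,3}\<close>. A loop, drawn as a closed curve, only adds to the set that represents its
  branch set.\<close>

lemma planar_no_K6_minor:
  fixes pt :: "'v \<Rightarrow> complex" and \<gamma> :: "'e \<Rightarrow> real \<Rightarrow> complex"
  assumes pt: "inj_on pt V"
    and ends: "\<And>e. e \<in> Ar \<Longrightarrow> src e \<in> V \<and> dst e \<in> V"
    and \<gamma>: "\<And>e. e \<in> Ar \<Longrightarrow> simple_path (\<gamma> e) \<and> pathstart (\<gamma> e) = pt (src e) \<and>
      pathfinish (\<gamma> e) = pt (dst e) \<and> path_image (\<gamma> e) \<inter> pt ` V = {pt (src e), pt (dst e)}"
    and \<gamma>\<gamma>: "\<And>e f. e \<in> Ar \<Longrightarrow> f \<in> Ar \<Longrightarrow> e \<noteq> f \<Longrightarrow> path_image (\<gamma> e) \<inter> path_image (\<gamma> f) \<subseteq> pt ` V"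
  defines "E \<equiv> \<lambda>u v. \<exists>e\<in>Ar. src e = u \<and> dst e = v \<or> src e = v \<and> dst e = u"
  assumes minor: "clique_minor E V CC"
  shows "card CC \<noteq> 6"
proof
  assume card: "card CC = 6"
  then have "finite CC" using card.infinite by fastforce
  then obtain f where f: "bij_betw f {..<6::nat} CC"
    using ex_bij_betw_nat_finite card by (metis atLeast0LessThan)
  have f_CC: "f i \<in> CC" if "i < 6" for i using f that by (auto simp: bij_betw_def)
  have f_ne: "f i \<noteq> f j" if "i < 6" "j < 6" "i \<noteq> j" for i j
    using f that by (auto simp: bij_betw_def dest: inj_onD)
  have f_V: "f i \<subseteq> V" and f_con: "connected_in E (f i)" if "i < 6" for i
    using minor f_CC[OF that] by (auto simp: clique_minor_def)
  have f_disj: "f i \<inter> f j = {}" and f_adj: "\<exists>u\<in>f i. \<exists>v\<in>f j. E u v"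
    if "i < 6" "j < 6" "i \<noteq> j" for i j
    using minor f_CC[OF that(1)] f_CC[OF that(2)] f_ne[OF that] by (auto simp: clique_minor_def)

  \<comment> \<open>\<open>S U\<close> is the drawing of the subgraph induced by \<open>U\<close>;
    for a branch set it takes the part of a vertex of \<open>K_{3,3}\<close>.\<close>
  define S where "S U = pt ` U \<union> (\<Union>e\<in>{e \<in> Ar. src e \<in> U \<and> dst e \<in> U}. path_image (\<gamma> e))" for U
  have path_\<gamma>: "path (\<gamma> e)" if "e \<in> Ar" for e using \<gamma>[OF that] simple_path_imp_path by blast
  have S_edge: "path_component (S U) (pt (src e)) z"
    if e: "e \<in> Ar" "src e \<in> U" "dst e \<in> U" "z \<in> path_image (\<gamma> e)" for U e z
  proof (rule path_component_of_subset)
    show "path_image (\<gamma> e) \<subseteq> S U" using e by (auto simp: S_def)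
    have "pt (src e) \<in> path_image (\<gamma> e)" using \<gamma>[OF e(1)] by (metis pathstart_in_path_image)
    then show "path_component (path_image (\<gamma> e)) (pt (src e)) z"
      using path_connected_path_image[OF path_\<gamma>[OF e(1)]] e(4) by (simp add: path_connected_component)
  qed
  have S_con: "path_connected (S U)" if U: "connected_in E U" for U
  proof -
    obtain u0 where u0: "u0 \<in> U" using U by (auto simp: connected_in_def)
    let ?A = "{v. path_component (S U) (pt u0) (pt v)}"
    have "U \<subseteq> ?A"
    proof (rule connected_in_subset[OF U])
      have "path_component (S U) (pt u0) (pt u0)"
        using u0 by (intro path_component_refl) (auto simp: S_def)
      then show "U \<inter> ?A \<noteq> {}" using u0 by blast
      fix u v assume uv: "u \<in> U \<inter> ?A" "v \<in> U" "E u v"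
      then obtain e where e: "e \<in> Ar" "src e = u \<and> dst e = v \<or> src e = v \<and> dst e = u"
        by (auto simp: E_def)
      have "pt (dst e) \<in> path_image (\<gamma> e)" using \<gamma>[OF e(1)] by (metis pathfinish_in_path_image)
      then have "path_component (S U) (pt (src e)) (pt (dst e))"
        using e uv by (intro S_edge) auto
      then have "path_component (S U) (pt u) (pt v)"
        using e(2) path_component_sym by metis
      then show "v \<in> ?A" using uv(1) path_component_trans by fast
    qed
    then have vertex: "path_component (S U) (pt u0) (pt v)" if "v \<in> U" for v using that by blast
    have all: "path_component (S U) (pt u0) z" if z: "z \<in> S U" for z
    proof -
      consider v where "v \<in> U" "z = pt v"
        | e where "e \<in> Ar" "src e \<in> U" "dst e \<in> U" "z \<in> path_image (\<gamma> e)"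
        using z unfolding S_def by blast
      then show ?thesis
      proof cases
        case 1
        then show ?thesis using vertex by simp
      next
        case 2
        then show ?thesis using vertex[of "src e"] S_edge[of e U z] path_component_trans by blast
      qed
    qed
    then show ?thesis
      unfolding path_connected_component using path_component_sym path_component_trans by blast
  qed
  have S_pt: "u \<in> U" if u: "u \<in> V" "pt u \<in> S U" "U \<subseteq> V" for u U
  proof -
    consider v where "v \<in> U" "pt u = pt v"
      | e where "e \<in> Ar" "src e \<in> U" "dst e \<in> U" "pt u \<in> path_image (\<gamma> e)"
      using u(2) unfolding S_def by blast
    then show ?thesis
    proof cases
      case 1
      then show ?thesis using inj_onD[OF pt, of u v] \<open>u \<in> V\<close> \<open>U \<subseteq> V\<close> by auto
    next
      case 2
      then have "pt u = pt (src e) \<or> pt u = pt (dst e)"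
        using \<gamma>[OF 2(1)] \<open>u \<in> V\<close> by blast
      then show ?thesis
        using inj_onD[OF pt, of u "src e"] inj_onD[OF pt, of u "dst e"] ends[OF 2(1)] 2 \<open>u \<in> V\<close> by auto
    qed
  qed
  have S_disj: "S U \<inter> S W = {}" if UW: "U \<subseteq> V" "W \<subseteq> V" "U \<inter> W = {}" for U W
  proof (rule ccontr)
    assume "S U \<inter> S W \<noteq> {}"
    then obtain z where z: "z \<in> S U" "z \<in> S W" by blast
    have "z \<notin> pt ` V" using S_pt[OF _ _ UW(1)] S_pt[OF _ _ UW(2)] z UW(3) by blast
    then obtain e e' where e: "e \<in> Ar" "src e \<in> U" "z \<in> path_image (\<gamma> e)"
      "e' \<in> Ar" "src e' \<in> W" "z \<in> path_image (\<gamma> e')"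
      using z UW unfolding S_def by blast
    then show False using \<gamma>\<gamma>[of e e'] UW(3) \<open>z \<notin> pt ` V\<close> by blast
  qed

  have "\<exists>e u v. e \<in> Ar \<and> u \<in> f i \<and> v \<in> f (3 + j) \<and> (src e = u \<and> dst e = v \<or> src e = v \<and> dst e = u)"
    if "i < 3" "j < 3" for i j
    using f_adj[of i "3 + j"] that unfolding E_def by auto
  then obtain e u v where e: "\<And>i j. i < 3 \<Longrightarrow> j < 3 \<Longrightarrow> e i j \<in> Ar \<and> u i j \<in> f i \<and> v i j \<in> f (3 + j) \<and>
    (src (e i j) = u i j \<and> dst (e i j) = v i j \<or> src (e i j) = v i j \<and> dst (e i j) = u i j)"
    by metis
  define g where "g i j = (if src (e i j) = u i j then \<gamma> (e i j) else reversepath (\<gamma> (e i j)))" for i j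
  have uv: "u i j \<in> V" "v i j \<in> V" "u i j \<noteq> v i j" if "i < 3" "j < 3" for i j
    using e[OF that] f_V[of i] f_V[of "3 + j"] f_disj[of i "3 + j"] that by auto
  have g_img: "path_image (g i j) = path_image (\<gamma> (e i j))" for i j by (simp add: g_def)
  have g: "arc (g i j) \<and> g i j 0 = pt (u i j) \<and> g i j 1 = pt (v i j)" if "i < 3" "j < 3" for i j
  proof -
    have "simple_path (g i j)" using \<gamma>[of "e i j"] e[OF that] by (simp add: g_def simple_path_reversepath)
    moreover have "pathstart (g i j) = pt (u i j)" "pathfinish (g i j) = pt (v i j)"
      using \<gamma>[of "e i j"] e[OF that] uv[OF that] by (auto simp: g_def)
    moreover have "pt (u i j) \<noteq> pt (v i j)"
      using inj_onD[OF pt] uv[OF that] by blast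
    ultimately show ?thesis by (auto simp: arc_simple_path pathstart_def pathfinish_def)
  qed
  have g_V: "g i j s \<notin> pt ` V" if ij: "i < 3" "j < 3" and s: "0 < s" "s < 1" for i j s
  proof
    assume "g i j s \<in> pt ` V"
    moreover have "g i j s \<in> path_image (g i j)" using s by (auto simp: path_image_def)
    ultimately have "g i j s \<in> {pt (src (e i j)), pt (dst (e i j))}"
      using \<gamma>[of "e i j"] e[OF ij] unfolding g_img by blast
    then have "g i j s = g i j 0 \<or> g i j s = g i j 1" using g[OF ij] e[OF ij] by auto
    moreover have "inj_on (g i j) {0..1}" using g[OF ij] by (simp add: arc_def)
    ultimately show False using inj_onD[of "g i j" "{0..1}" s] s by auto
  qed
  have g_S: "g i j s \<notin> S (f k)" if ij: "i < 3" "j < 3" and k: "k < 6" and s: "0 < s" "s < 1" for i j k s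
  proof
    assume "g i j s \<in> S (f k)"
    then obtain e' where e': "e' \<in> Ar" "src e' \<in> f k" "dst e' \<in> f k" "g i j s \<in> path_image (\<gamma> e')"
      using g_V[OF ij s] f_V[OF k] unfolding S_def by blast
    have "g i j s \<in> path_image (\<gamma> (e i j))"
      using s unfolding g_img[symmetric] by (auto simp: path_image_def)
    moreover have "e i j \<noteq> e'"
      using e[OF ij] e' f_disj[of i "3 + j"] f_disj[of i k] f_disj[of "3 + j" k] ij k
      by (cases "k = i") auto
    ultimately show False
      using \<gamma>\<gamma>[of "e i j" e'] e[OF ij] e' g_V[OF ij s] by blast
  qed
  show False
  proof (rule not_planar_K33[of "\<lambda>i. S (f i)" "\<lambda>i. S (f (3 + i))" g])
    fix i j :: nat assume ij: "i < 3" "j < 3"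
    show "S (f i) \<inter> S (f (3 + j)) = {}"
      using ij by (intro S_disj f_V f_disj) auto
    show "arc (g i j) \<and> g i j 0 \<in> S (f i) \<and> g i j 1 \<in> S (f (3 + j))"
      using g[OF ij] e[OF ij] by (auto simp: S_def)
    show "g i j s \<notin> S (f k) \<and> g i j s \<notin> S (f (3 + k))" if "k < 3" "0 < s" "s < 1" for k s
      using g_S[OF ij, of k s] g_S[OF ij, of "3 + k" s] that by auto
    show "S (f i) \<inter> S (f j) = {}" if "i \<noteq> j"
      using ij that by (intro S_disj f_V f_disj) auto
    show "S (f (3 + i)) \<inter> S (f (3 + j)) = {}" if "i \<noteq> j"
      using ij that by (intro S_disj f_V f_disj) auto
    fix i' j' :: nat and s t :: real
    assume ij': "i' < 3" "j' < 3" and s: "0 < s" "s < 1" and t: "0 < t" "t < 1"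
      and eq: "g i j s = g i' j' t"
    have "g i j s \<in> path_image (\<gamma> (e i j))" "g i' j' t \<in> path_image (\<gamma> (e i' j'))"
      using s t unfolding g_img[symmetric] by (auto simp: path_image_def)
    then have "e i j = e i' j'"
      using \<gamma>\<gamma>[of "e i j" "e i' j'"] g_V[OF ij s] e[OF ij] e[OF ij'] eq by auto
    then have "u i j = u i' j' \<and> v i j = v i' j' \<or> u i j = v i' j' \<and> v i j = u i' j'"
      using e[OF ij] e[OF ij'] by metis
    moreover have "u i j \<noteq> v i' j'"
      using e[OF ij] e[OF ij'] f_disj[of i "3 + j'"] ij ij' by auto
    ultimately have "u i j = u i' j'" "v i j = v i' j'" by auto
    then have "f i \<inter> f i' \<noteq> {}" "f (3 + j) \<inter> f (3 + j') \<noteq> {}"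
      using e[OF ij] e[OF ij'] by (metis disjoint_iff)+
    then show "i = i' \<and> j = j'"
      using f_disj[of i i'] f_disj[of "3 + j" "3 + j'"] ij ij' by auto
  next
    fix i :: nat assume "i < 3"
    then show "path_connected (S (f i))" "path_connected (S (f (3 + i)))"
      by (auto intro!: S_con f_con)
  qed
qed

section \<open>Linear forms computed by a circuit\<close>

lemma underdetermined_system:
  fixes a :: "'n \<Rightarrow> nat \<Rightarrow> 'a::field"
  assumes "finite N" "card N < k"
  obtains w where "\<exists>j<k. w j \<noteq> 0" "\<And>u. u \<in> N \<Longrightarrow> (\<Sum>j<k. w j * a u j) = 0"
proof -
  obtain xs where xs: "set xs = N" "length xs = card N"
    using assms(1) finite_distinct_list distinct_card by metis
  \<comment> \<open>The zero row at \<open>k - 1\<close> makes the determinant vanish, and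
    \<open>card N < k\<close> leaves the rows before it for all equations. Surplus rows hold
    arbitrary values of \<open>xs ! i\<close> and only add conditions.\<close>
  define A where "A = mat\<^sub>r k k (\<lambda>i. if i = k - 1 then 0\<^sub>v k else vec k (a (xs ! i)))"
  have A: "A \<in> carrier_mat k k" by (simp add: A_def)
  have "det A = 0" unfolding A_def using assms(2) by (intro det_row_0) auto
  then obtain v where v: "v \<in> carrier_vec k" "v \<noteq> 0\<^sub>v k" "A *\<^sub>v v = 0\<^sub>v k"
    using det_0_iff_vec_prod_zero[OF A] by blast
  show ?thesis
  proof (rule that[of "\<lambda>j. v $ j"])
    show "\<exists>j<k. v $ j \<noteq> 0"
      using v(1,2) by (metis carrier_vecD eq_vecI index_zero_vec)
    fix u assume "u \<in> N"
    then obtain i where i: "i < card N" "xs ! i = u" using xs by (metis in_set_conv_nth)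
    then have ik: "i < k" "i \<noteq> k - 1" using assms(2) by auto
    then have "row A i = vec k (a u)" by (simp add: A_def i(2))
    moreover have "(A *\<^sub>v v) $ i = row A i \<bullet> v" using ik A by auto
    ultimately have "vec k (a u) \<bullet> v = 0" using v(3) ik by simp
    moreover have "(\<Sum>j<k. v $ j * a u j) = (\<Sum>j<k. vec k (a u) $ j * v $ j)"
      by (intro sum.cong) auto
    ultimately show "(\<Sum>j<k. v $ j * a u j) = 0"
      using v(1) by (simp add: scalar_prod_def atLeast0LessThan)
  qed
qed

text \<open>The derivative of \<open>p\<close> at the origin, in the direction that is the sum over
  \<open>l < k\<close> of \<open>w l\<close> times the unit vector of the variable
  \<open>q l\<close>.\<close>

definition lin_form :: "nat \<Rightarrow> (nat \<Rightarrow> nat) \<Rightarrow> (nat \<Rightarrow> 'a) \<Rightarrow> 'a::field mpoly \<Rightarrow> 'a" where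
  "lin_form k q w p = (\<Sum>l<k. w l * Poly_Mapping.lookup p (Poly_Mapping.single (q l) 1))"

text \<open>A monomial of degree one splits only into the trivial monomial and itself, in either
  order. This is the product rule at the origin.\<close>

lemma lookup_mult_degree_one:
  fixes p r :: "'a::field mpoly"
  shows "Poly_Mapping.lookup (p * r) (Poly_Mapping.single i 1) =
    Poly_Mapping.lookup p 0 * Poly_Mapping.lookup r (Poly_Mapping.single i 1) +
    Poly_Mapping.lookup p (Poly_Mapping.single i 1) * Poly_Mapping.lookup r 0"
proof -
  let ?s = "Poly_Mapping.single i 1 :: nat \<Rightarrow>\<^sub>0 nat"
  let ?f = "\<lambda>l. Poly_Mapping.lookup p l * (\<Sum>m. Poly_Mapping.lookup r m when ?s = l + m)"
  have s0: "?s \<noteq> 0" by (metis lookup_single_eq lookup_zero zero_neq_one)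
  have split: "l = 0 \<or> l = ?s" if "?s = l + m" for l m
  proof -
    have eq: "Poly_Mapping.lookup ?s j = Poly_Mapping.lookup l j + Poly_Mapping.lookup m j" for j
      using that by (metis lookup_add)
    have other: "Poly_Mapping.lookup l j = 0" if "j \<noteq> i" for j
      using eq[of j] that by (simp add: lookup_single_not_eq)
    show ?thesis
    proof (cases "Poly_Mapping.lookup l i = 0")
      case True
      then have "l = 0" using other by (intro poly_mapping_eqI) (metis lookup_zero)
      then show ?thesis ..
    next
      case False
      then have "Poly_Mapping.lookup l i = 1" using eq[of i] by simp
      then have "l = ?s"
        using other by (intro poly_mapping_eqI) (metis lookup_single_eq lookup_single_not_eq)
      then show ?thesis ..
    qed
  qed
  have zero: "?f l = 0" if "l \<notin> {0, ?s}" for l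
  proof -
    have "?s \<noteq> l + m" for m using split[of l m] that by blast
    then show ?thesis by (simp add: when_def)
  qed
  have "Poly_Mapping.lookup (p * r) ?s = (\<Sum>l. ?f l)" by (rule lookup_mult)
  also have "\<dots> = (\<Sum>l\<in>{0, ?s}. ?f l)"
    by (rule Sum_any.expand_superset) (use zero in auto)
  also have "\<dots> = ?f 0 + ?f ?s" using s0 by simp
  also have "?f 0 = Poly_Mapping.lookup p 0 * Poly_Mapping.lookup r ?s" by simp
  also have "(\<lambda>m. Poly_Mapping.lookup r m when ?s = ?s + m) =
      (\<lambda>m. Poly_Mapping.lookup r m when m = 0)" by auto
  then have "?f ?s = Poly_Mapping.lookup p ?s * Poly_Mapping.lookup r 0" by simp
  finally show ?thesis .
qed

lemma lin_form_mult:
  "lin_form k q w (p * r) =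
    Poly_Mapping.lookup p 0 * lin_form k q w r + lin_form k q w p * Poly_Mapping.lookup r 0"
  by (simp add: lin_form_def lookup_mult_degree_one[unfolded One_nat_def] distrib_left sum.distrib
      sum_distrib_left sum_distrib_right algebra_simps)

lemma lin_form_mconst: "lin_form k q w (mconst c) = 0"
proof -
  have "Poly_Mapping.single i (1::nat) \<noteq> 0" for i :: nat
    by (metis lookup_single_eq lookup_zero zero_neq_one)
  then show ?thesis by (simp add: lin_form_def mconst_def lookup_single_not_eq[OF not_sym])
qed

lemma lin_form_mvar: "lin_form k q w (mvar i) = (\<Sum>l<k. w l * (if q l = i then 1 else 0))"
proof -
  have "Poly_Mapping.single i (1::nat) = Poly_Mapping.single j 1 \<longleftrightarrow> i = j" for i j :: nat
    by (metis lookup_single_eq lookup_single_not_eq zero_neq_one)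
  then show ?thesis
    unfolding lin_form_def mvar_def
    by (intro sum.cong) (auto simp: lookup_single when_def)
qed

lemma lin_form_scale: "lin_form k q w (mconst c * p) = c * lin_form k q w p"
  by (simp add: lin_form_mult lin_form_mconst) (simp add: mconst_def)

lemma lin_form_sum: "lin_form k q w (sum f A) = (\<Sum>x\<in>A. lin_form k q w (f x))"
  by (simp add: lin_form_def lookup_sum sum_distrib_left) (rule sum.swap)

lemma lin_form_one: "lin_form k q w 1 = 0"
  using lin_form_mconst[of k q w 1] by (simp add: mconst_def)

lemma lin_form_prod:
  assumes "finite A" "\<And>x. x \<in> A \<Longrightarrow> lin_form k q w (f x) = 0"
  shows "lin_form k q w (prod f A) = 0"
  using assms by (induction A rule: finite_induct) (auto simp: lin_form_one lin_form_mult)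

text \<open>Vanishing passes through sums by linearity and through products because each term of the
  product rule contains the derivative of a factor. An operand comes either from \<open>R\<close>,
  where induction applies, or across a wire entering \<open>R\<close>, where \<open>bd\<close>
  does.\<close>

lemma lin_form_gate_zero:
  assumes "computes G gate label v p" and "fin_digraph G" and "v \<in> R"
    and vars: "\<And>v i l. v \<in> R \<Longrightarrow> gate v = Variable i \<Longrightarrow> l < k \<Longrightarrow> q l \<noteq> i"
    and bd: "\<And>e p. e \<in> arcs G \<Longrightarrow> head G e \<in> R \<Longrightarrow> tail G e \<notin> R \<Longrightarrow>
      computes G gate label (tail G e) p \<Longrightarrow> lin_form k q w p = 0"
  shows "lin_form k q w p = 0"
  using assms(1,3)
proof (induction rule: computes.induct)
  case (var_gate v i)
  then show ?case using vars by (auto simp: lin_form_mvar)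
next
  case (const_gate v c)
  then show ?case by (simp add: lin_form_mconst)
next
  case (plus_gate v p)
  have "lin_form k q w (p e) = 0" if "e \<in> in_arcs G v" for e
    using that plus_gate bd[of e "p e"] by (cases "tail G e \<in> R") auto
  then show ?case by (simp add: lin_form_sum lin_form_scale)
next
  case (times_gate v p)
  have "lin_form k q w (p e) = 0" if "e \<in> in_arcs G v" for e
    using that times_gate bd[of e "p e"] by (cases "tail G e \<in> R") auto
  moreover have "finite (in_arcs G v)" using assms(2) by (simp add: fin_digraph.finite_in_arcs)
  ultimately show ?case by (intro lin_form_prod) (auto simp: lin_form_scale)
qed

lemma vec_index_mult_mvar:
  assumes "M \<in> carrier_mat n n" "i < n"
  shows "vec_index (map_mat mconst M *\<^sub>v vec n mvar) i = (\<Sum>j<n. mconst (M $$ (i, j)) * mvar j)"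
  using assms by (auto simp: scalar_prod_def atLeast0LessThan intro!: sum.cong)

lemma lin_form_output:
  assumes "\<And>l. l < k \<Longrightarrow> q l < n"
  shows "lin_form k q w (\<Sum>j<n. mconst (m j) * mvar j) = (\<Sum>l<k. m (q l) * w l)"
proof -
  have "lin_form k q w (\<Sum>j<n. mconst (m j) * mvar j) =
    (\<Sum>j<n. \<Sum>l<k. if q l = j then m j * w l else 0)"
    by (auto simp: lin_form_sum lin_form_scale lin_form_mvar sum_distrib_left intro!: sum.cong)
  also have "\<dots> = (\<Sum>l<k. \<Sum>j<n. if q l = j then m j * w l else 0)" by (rule sum.swap)
  also have "\<dots> = (\<Sum>l<k. m (q l) * w l)" using assms by (intro sum.cong) auto
  finally show ?thesis .
qed

section \<open>Outputs and neighbours of a small set of gates\<close>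

lemma singular_submatrix:
  assumes M: "M \<in> carrier_mat n n" and I: "I \<subseteq> {..<n}" "card I = k" and J: "J \<subseteq> {..<n}" "card J = k"
    and w: "\<exists>l<k. w l \<noteq> 0" "\<And>i. i \<in> I \<Longrightarrow> (\<Sum>l<k. M $$ (i, pick J l) * w l) = 0"
  shows "det (submatrix M I J) = (0::'a::field)"
proof -
  let ?S = "submatrix M I J"
  have "{i. i < dim_row M \<and> i \<in> I} = I" "{j. j < dim_col M \<and> j \<in> J} = J" using M I J by auto
  then have S: "?S = mat k k (\<lambda>(i, j). M $$ (pick I i, pick J j))"
    using I J by (simp add: submatrix_def)
  then have carrier: "?S \<in> carrier_mat k k" by simp
  have "?S *\<^sub>v vec k w = 0\<^sub>v k"
  proof (rule eq_vecI)
    fix i assume "i < dim_vec (0\<^sub>v k :: 'a vec)"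
    then have "i < k" "pick I i \<in> I" using I pick_in_set_le by auto
    then show "(?S *\<^sub>v vec k w) $ i = 0\<^sub>v k $ i"
      using w(2)[of "pick I i"] by (simp add: S scalar_prod_def atLeast0LessThan)
  qed (simp add: S)
  moreover have "vec k w \<noteq> 0\<^sub>v k" using w(1) by (metis index_vec index_zero_vec(1))
  ultimately show ?thesis
    using det_0_iff_vec_prod_zero[OF carrier] vec_carrier by blast
qed

lemma (in arithmetic_circuit) outputs_le_boundary:
  assumes M: "M \<in> carrier_mat n n" and reg: "totally_regular M"
    and out: "\<And>i. i < n \<Longrightarrow>
      computes G gate label (out i) (vec_index (map_mat mconst M *\<^sub>v vec n mvar) i)"
    and inj: "inj_on out {..<n}"
    and R: "R \<subseteq> verts G" "2 * card R \<le> n"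
  shows "card {i. i < n \<and> out i \<in> R} \<le> card {u \<in> verts G - R. \<exists>e\<in>arcs G. tail G e = u \<and> head G e \<in> R}"
    (is "card ?I \<le> card ?N")
proof (rule ccontr)
  assume less: "\<not> card ?I \<le> card ?N"
  define k where "k = card ?I"
  let ?vars = "{i. \<exists>v\<in>R. gate v = Variable i}"
  have finR: "finite R" using finite_subset[OF R(1) finite_verts] .
  \<comment> \<open>A gate reads at most one variable; the arbitrary value of \<open>THE\<close> at
    the other gates of \<open>R\<close> only enlarges the image.\<close>
  have "?vars \<subseteq> (\<lambda>v. THE i. gate v = Variable i) ` R"
    by (force intro!: image_eqI)
  then have vars: "finite ?vars" "card ?vars \<le> card R"
    using finite_subset[OF _ finite_imageI[OF finR]] surj_card_le[OF finR] by blast+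
  have "out ` ?I \<subseteq> R" by auto
  moreover have "inj_on out ?I" using inj by (rule inj_on_subset) auto
  ultimately have "k \<le> card R" using finR unfolding k_def by (metis card_inj_on_le)
  \<comment> \<open>Here \<open>2 * card R \<le> n\<close> is spent: the \<open>k\<close> output
    rows need \<open>k\<close> columns of variables that are not read in \<open>R\<close>.\<close>
  also have "\<dots> \<le> n - card ?vars" using R(2) vars(2) by linarith
  also have "\<dots> \<le> card ({..<n} - ?vars)" using diff_card_le_card_Diff[OF vars(1), of "{..<n}"] by simp
  finally obtain J where J: "J \<subseteq> {..<n} - ?vars" "card J = k"
    by (rule obtain_subset_with_card_n)
  let ?val = "\<lambda>u. THE p. computes G gate label u p"
  have N: "finite ?N" "card ?N < k" using less by (auto simp: k_def)
  obtain w where w: "\<exists>j<k. w j \<noteq> 0"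
    "\<And>u. u \<in> ?N \<Longrightarrow> (\<Sum>l<k. w l * Poly_Mapping.lookup (?val u) (Poly_Mapping.single (pick J l) 1)) = 0"
    by (rule underdetermined_system[OF N,
          of "\<lambda>u l. Poly_Mapping.lookup (?val u) (Poly_Mapping.single (pick J l) 1)"]) (rule that)
  have q: "pick J l \<in> J" if "l < k" for l using that J(2) pick_in_set_le by auto
  have bd: "lin_form k (pick J) w p = 0"
    if e: "e \<in> arcs G" "head G e \<in> R" "tail G e \<notin> R" and p: "computes G gate label (tail G e) p" for e p
  proof -
    have "tail G e \<in> ?N" using e by auto
    moreover have "?val (tail G e) = p"
      using ex1_computes[of "tail G e"] p e(1) by (intro the1_equality) auto
    ultimately show ?thesis using w(2)[of "tail G e"] by (simp add: lin_form_def)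
  qed
  have "(\<Sum>l<k. M $$ (i, pick J l) * w l) = 0" if i: "i \<in> ?I" for i
  proof -
    have "lin_form k (pick J) w (vec_index (map_mat mconst M *\<^sub>v vec n mvar) i) = 0"
    proof (rule lin_form_gate_zero[OF out])
      show "pick J l \<noteq> i'" if "v \<in> R" "gate v = Variable i'" "l < k" for v i' l
        using q[OF that(3)] J(1) that(1,2) by auto
    qed (use i bd in \<open>auto intro: fin_digraph_axioms\<close>)
    moreover have "pick J l < n" if "l < k" for l using q[OF that] J(1) by auto
    ultimately show ?thesis
      using lin_form_output[of k "pick J" n w "\<lambda>j. M $$ (i, j)"] vec_index_mult_mvar[OF M] i by simp
  qed
  then have "det (submatrix M ?I J) = 0"
    using M J w(1) by (intro singular_submatrix[of M n ?I k J w]) (auto simp: k_def)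
  moreover have "?I \<subseteq> {..<dim_row M}" "J \<subseteq> {..<dim_col M}" "card ?I = card J"
    using M J by (auto simp: k_def)
  ultimately show False using reg unfolding totally_regular_def by blast
qed

text \<open>A gate serving two rows would make them equal, and the minor on these rows and the
  columns 0 and 1 would vanish. Injectivity is what gives \<open>n\<close> different target gates to
  count.\<close>

lemma (in arithmetic_circuit) outputs_inj:
  assumes M: "M \<in> carrier_mat n n" and reg: "totally_regular M"
    and out: "\<And>i. i < n \<Longrightarrow>
      out i \<in> verts G \<and> computes G gate label (out i) (vec_index (map_mat mconst M *\<^sub>v vec n mvar) i)"
  shows "inj_on out {..<n}"
proof (rule inj_onI, rule ccontr)
  fix i i' assume i: "i \<in> {..<n}" "i' \<in> {..<n}" "out i = out i'" "i \<noteq> i'"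
  then have eq: "vec_index (map_mat mconst M *\<^sub>v vec n mvar) i =
      vec_index (map_mat mconst M *\<^sub>v vec n mvar) i'"
    using out[of i] out[of i'] ex1_computes[of "out i" label] by auto
  have "{i, i'} \<subseteq> {..<n}" "card {i, i'} = 2" using i by auto
  define J where "J = {0, 1::nat}"
  have J: "J \<subseteq> {..<n}" "card J = 2" using i by (auto simp: J_def)
  have pick01: "pick J l \<in> J" if "l < 2" for l using J that pick_in_set_le by auto
  have entry: "M $$ (i, j) = M $$ (i', j)" if "j < n" for j
  proof -
    \<comment> \<open>The derivative along the single variable \<open>j\<close> reads off an entry
      of the matrix.\<close>
    have "lin_form 1 (\<lambda>_. j) (\<lambda>_. 1) (vec_index (map_mat mconst M *\<^sub>v vec n mvar) a) = M $$ (a, j)"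
      if "a < n" for a
      using vec_index_mult_mvar[OF M that] lin_form_output[of 1 "\<lambda>_. j" n "\<lambda>_. 1" "\<lambda>j. M $$ (a, j)"]
        \<open>j < n\<close> by simp
    then show ?thesis using eq i by (metis lessThan_iff)
  qed
  let ?S = "submatrix M {i, i'} J"
  have "{l. l < dim_row M \<and> l \<in> {i, i'}} = {i, i'}"
    "{j. j < dim_col M \<and> j \<in> J} = J" using M i J by auto
  then have S: "?S = mat 2 2 (\<lambda>(a, b). M $$ (pick {i, i'} a, pick J b))"
    unfolding submatrix_def using J(2) \<open>card {i, i'} = 2\<close> by presburger
  have "pick {i, i'} a \<in> {i, i'}" if "a < 2" for a
    using \<open>card {i, i'} = 2\<close> that pick_in_set_le by metis
  then have "M $$ (pick {i, i'} a, pick J b) = M $$ (i, pick J b)" if "a < 2" "b < 2" for a b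
    using entry[of "pick J b"] pick01[OF that(2)] J that by fastforce
  then have "M $$ (pick {i, i'} 0, pick J b) = M $$ (pick {i, i'} 1, pick J b)" if "b < 2" for b
    using that by (metis pos2 one_less_numeral_iff semiring_norm(76))
  then have "row ?S 0 = row ?S 1" by (intro eq_vecI) (simp_all add: S del: pick.simps)
  then have "det ?S = 0" by (intro det_identical_rows[of _ 2 0 1]) (auto simp: S)
  moreover have "{i, i'} \<subseteq> {..<dim_row M}" "J \<subseteq> {..<dim_col M}" "card {i, i'} = card J"
    using M J i by auto
  ultimately show False using reg unfolding totally_regular_def by blast
qed

section \<open>The size of planar circuits\<close>

text \<open>The inner vertex boundary, in contrast to the outer one given by
  \<open>nbrs\<close>.\<close>

definition boundary :: "('v \<Rightarrow> 'v \<Rightarrow> bool) \<Rightarrow> 'v set \<Rightarrow> 'v set \<Rightarrow> 'v set" where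
  "boundary E V P = {v \<in> P. \<exists>u\<in>V - P. E u v}"

lemma clique_minor_mono:
  assumes "clique_minor E P CC" "P \<subseteq> V"
  shows "clique_minor E V CC"
proof -
  have "\<forall>C\<in>CC. C \<subseteq> V \<and> connected_in E C"
    using assms by (simp add: clique_minor_def) (meson order_trans)
  then show ?thesis using assms(1) by (simp add: clique_minor_def)
qed

text \<open>A vertex of \<open>A - B\<close> has no neighbour in \<open>B - A\<close>, so its
  neighbours outside \<open>A\<close> are outside \<open>P\<close> too. Only separator vertices can
  become new boundary, once for each side.\<close>

lemma card_boundary_split:
  assumes "finite V" "P \<subseteq> V" "A \<union> B = P"
    and no_edge: "\<And>u v. u \<in> A - B \<Longrightarrow> v \<in> B - A \<Longrightarrow> \<not> E u v" and sym: "symp E"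
  shows "card (boundary E V A) + card (boundary E V B) \<le> card (boundary E V P) + 2 * card (A \<inter> B)"
proof -
  let ?bd = "boundary E V"
  have fin: "finite A" "finite B" "finite P" using assms finite_subset by auto
  have "?bd A \<subseteq> (?bd P \<inter> (A - B)) \<union> (A \<inter> B)"
    using assms sympD[OF sym] unfolding boundary_def by blast
  then have "card (?bd A) \<le> card ((?bd P \<inter> (A - B)) \<union> (A \<inter> B))"
    using fin by (intro card_mono) auto
  also have "\<dots> \<le> card (?bd P \<inter> (A - B)) + card (A \<inter> B)" by (rule card_Un_le)
  finally have A: "card (?bd A) \<le> card (?bd P \<inter> (A - B)) + card (A \<inter> B)" .
  have "?bd B \<subseteq> (?bd P \<inter> (B - A)) \<union> (A \<inter> B)"
    using assms unfolding boundary_def by blast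
  then have "card (?bd B) \<le> card ((?bd P \<inter> (B - A)) \<union> (A \<inter> B))"
    using fin by (intro card_mono) auto
  also have "\<dots> \<le> card (?bd P \<inter> (B - A)) + card (A \<inter> B)" by (rule card_Un_le)
  finally have B: "card (?bd B) \<le> card (?bd P \<inter> (B - A)) + card (A \<inter> B)" .
  have "card (?bd P \<inter> (A - B)) + card (?bd P \<inter> (B - A)) =
      card ((?bd P \<inter> (A - B)) \<union> (?bd P \<inter> (B - A)))"
    using fin by (intro card_Un_disjoint[symmetric]) auto
  also have "\<dots> \<le> card (?bd P)" using fin by (intro card_mono) (auto simp: boundary_def)
  finally show ?thesis using A B by linarith
qed

text \<open>
  The term \<open>- 1000 * sqrt (card P)\<close> pays for the separators of the recursion: a split of \<open>m\<close> vertices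
  along a separator of size at most \<open>30 * sqrt m\<close> increases the sum of the square roots by at least
  \<open>3/20 * sqrt m\<close>.
\<close>

lemma card_targets_le:
  fixes E :: "'v \<Rightarrow> 'v \<Rightarrow> bool" and n :: nat and a :: real
  assumes sym: "symp E" and fin: "finite V"
    and no_minor: "\<And>CC. clique_minor E V CC \<Longrightarrow> card CC \<noteq> 6"
    and small: "\<And>R. R \<subseteq> V \<Longrightarrow> 2 * card R \<le> n \<Longrightarrow> card (X \<inter> R) \<le> card (nbrs E V R)"
    and n: "n \<ge> 6000000"
    and P: "P \<subseteq> V" "n \<le> 6 * card P"
  defines "a \<equiv> 1000 * sqrt 6 / sqrt n"
  shows "real (card (X \<inter> P)) \<le> 2 * card (boundary E V P) + a * card P - 1000 * sqrt (card P)"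
  using P
proof (induction "card P" arbitrary: P rule: less_induct)
  case (less P)
  have finP: "finite P" using less.prems fin finite_subset by blast
  define m where "m = card P"
  have m: "real n \<le> 6 * real m" using less.prems(2) unfolding m_def by linarith
  have a0: "a \<ge> 0" by (simp add: a_def)
  show ?case
  proof (cases "2 * card P \<le> n")
    case True
    \<comment> \<open>All neighbours of \<open>R\<close> are boundary vertices of \<open>P\<close>.
      So the targets in \<open>R\<close> number at most the boundary, and those in the boundary
      itself likewise; hence the factor 2.\<close>
    define R where "R = P - boundary E V P"
    have R: "R \<subseteq> V" "R \<subseteq> P" using less.prems(1) by (auto simp: R_def)
    have "card R \<le> card P" using R(2) finP by (rule card_mono[rotated])
    then have "card (X \<inter> R) \<le> card (nbrs E V R)" using True by (intro small R(1)) linarith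
    also have "\<dots> \<le> card (boundary E V P)"
    proof (rule card_mono)
      show "finite (boundary E V P)" using finP by (simp add: boundary_def)
      show "nbrs E V R \<subseteq> boundary E V P"
        using sympD[OF sym] unfolding nbrs_def R_def boundary_def by blast
    qed
    finally have "card (X \<inter> R) \<le> card (boundary E V P)" .
    moreover have "card (X \<inter> P) \<le> card ((X \<inter> R) \<union> boundary E V P)"
      using finP R by (intro card_mono) (auto simp: R_def boundary_def)
    moreover have "card ((X \<inter> R) \<union> boundary E V P) \<le> card (X \<inter> R) + card (boundary E V P)"
      by (rule card_Un_le)
    ultimately have "card (X \<inter> P) \<le> 2 * card (boundary E V P)" by linarith
    \<comment> \<open>\<open>a\<close> is chosen for this estimate: when
      \<open>n \<le> 6 * m\<close>, the linear term outweighs the negative one.\<close>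
    moreover have "1000 * sqrt m \<le> a * m"
    proof -
      have "sqrt n \<le> sqrt 6 * sqrt m" using m by (simp flip: real_sqrt_mult)
      then have "1000 * sqrt m * sqrt n \<le> 1000 * sqrt m * (sqrt 6 * sqrt m)"
        by (intro mult_left_mono) auto
      also have "\<dots> = 1000 * sqrt 6 * m" by simp
      finally show ?thesis using n by (simp add: a_def field_simps)
    qed
    ultimately show ?thesis unfolding m_def by linarith
  next
    case False
    then have m_big: "real m \<ge> 3000000" using n unfolding m_def by linarith
    define b where "b = nat \<lceil>sqrt (6 * real m)\<rceil>"
    have b: "sqrt (6 * real m) \<le> b" "b \<le> sqrt (6 * real m) + 1" 
      using real_nat_ceiling_ge of_int_ceiling_le_add_one[of "sqrt (6 * real m)"]
      by (auto simp: b_def of_nat_nat)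
    have "6 * real m = sqrt (6 * real m) * sqrt (6 * real m)" by simp
    also have "\<dots> \<le> real b * real b" using b(1) by (intro mult_mono) auto
    finally have bb: "6 * card P \<le> b * b"
      unfolding m_def by (metis of_nat_le_iff of_nat_mult of_nat_numeral)
    have "card CC \<noteq> 6" if "clique_minor E P CC" for CC
      using no_minor clique_minor_mono that less.prems(1) by blast
    from minor_free_separator[OF sym finP this bb]
    obtain A B where AB: "A \<union> B = P" "card (A \<inter> B) \<le> 6 * b"
      and no_edge: "\<And>u v. u \<in> A - B \<Longrightarrow> v \<in> B - A \<Longrightarrow> \<not> E u v"
      and AB_big: "card P \<le> 3 * card A" "card P \<le> 3 * card B" by metis
    define x where "x = real (card (A \<inter> B))"
    have finAB: "finite A" "finite B" using AB(1) finP by auto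
    have cards: "card A + card B = m + card (A \<inter> B)"
      using card_Un_Int[OF finAB] AB(1) unfolding m_def by simp
    have sm: "sqrt m \<ge> 1700" by (rule real_le_rsqrt) (use m_big in simp)
    have "sqrt (6 * real m) \<le> 5/2 * sqrt m"
      by (rule real_le_lsqrt) (use m_big in \<open>auto simp: power_mult_distrib power2_eq_square\<close>)
    then have "6 * real b \<le> 30 * sqrt m" using b(2) sm by linarith
    then have x: "x \<le> 30 * sqrt m" using AB(2) unfolding x_def by linarith
    \<comment> \<open>Each side has at least a third of \<open>P\<close>, so a separator below a
      third makes both sides strictly smaller than \<open>P\<close>.\<close>
    have "1700 * sqrt m \<le> sqrt m * sqrt m" using sm by (intro mult_right_mono) auto
    then have "30 * sqrt m < m / 3" using sm by simp
    then have x_small: "x < m / 3" using x by simp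
    have "3 * real (card A) \<ge> m" "3 * real (card B) \<ge> m" using AB_big unfolding m_def by linarith+
    moreover have AB_sum: "real (card A) + real (card B) = m + x"
      using cards unfolding x_def by linarith
    ultimately have "real (card A) < m" "real (card B) < m" using x_small by linarith+
    then have lt: "card A < card P" "card B < card P" unfolding m_def by auto
    have sub: "A \<subseteq> V" "B \<subseteq> V" using AB(1) less.prems(1) by auto
    \<comment> \<open>A piece that is split has more than \<open>n / 2\<close> vertices and each
      side at least a third of them, so no piece falls below \<open>n / 6\<close>. This 6 is
      unrelated to the order of the clique.\<close>
    have nAB: "n \<le> 6 * card A" "n \<le> 6 * card B" using False AB_big by linarith+
    have "card (X \<inter> P) \<le> card ((X \<inter> A) \<union> (X \<inter> B))"
      using AB(1) finAB by (intro card_mono) auto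
    also have "\<dots> \<le> card (X \<inter> A) + card (X \<inter> B)" by (rule card_Un_le)
    finally have "real (card (X \<inter> P)) \<le> card (X \<inter> A) + card (X \<inter> B)" by linarith
    also have "\<dots> \<le> (2 * card (boundary E V A) + a * card A - 1000 * sqrt (card A)) +
      (2 * card (boundary E V B) + a * card B - 1000 * sqrt (card B))"
      using less.hyps[OF lt(1) sub(1) nAB(1)] less.hyps[OF lt(2) sub(2) nAB(2)] by linarith
    also have "\<dots> = 2 * real (card (boundary E V A) + card (boundary E V B)) +
      a * (real (card A) + real (card B)) - 1000 * (sqrt (card A) + sqrt (card B))"
      by (simp add: algebra_simps)
    also have "\<dots> \<le> 2 * (real (card (boundary E V P)) + 2 * x) + a * (m + x) - 1000 * (23/20 * sqrt m)"
    proof -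
      have "real (card (boundary E V A) + card (boundary E V B)) \<le> card (boundary E V P) + 2 * x"
        using card_boundary_split[OF fin less.prems(1) AB(1) no_edge sym] unfolding x_def by linarith
      \<comment> \<open>\<open>23/40\<close> is a rational number just below
        \<open>1 / sqrt 3\<close>; the two sides together give \<open>23/20\<close>.\<close>
      moreover have "23/40 * sqrt m \<le> sqrt y" if "3 * y \<ge> m" for y
        by (rule real_le_rsqrt) (use that in \<open>auto simp: power_mult_distrib power2_eq_square\<close>)
      then have "23/40 * sqrt m \<le> sqrt (card A)" "23/40 * sqrt m \<le> sqrt (card B)"
        using AB_big unfolding m_def
        by (simp_all del: of_nat_le_iff add: of_nat_le_iff[symmetric, where 'a = real])
      then have "23/20 * sqrt m \<le> sqrt (card A) + sqrt (card B)" by linarith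
      ultimately show ?thesis
        unfolding AB_sum by (intro diff_mono add_mono mult_left_mono order_refl) simp_all
    qed
    also have "\<dots> \<le> 2 * card (boundary E V P) + a * m - 1000 * sqrt m"
    proof -
      \<comment> \<open>The threshold \<open>n \<ge> 6000000\<close> amounts to
        \<open>a \<le> 1\<close>. The separator then costs at most
        \<open>5 * x \<le> 150 * sqrt m\<close>, which is exactly the gain
        \<open>1000 * (3/20) * sqrt m\<close>; this fixes the constant 1000.\<close>
      have "1000 * sqrt 6 \<le> sqrt n"
        using n by (intro real_le_rsqrt) (simp add: power_mult_distrib)
      then have "a \<le> 1" using n by (simp add: a_def divide_le_eq)
      then have "a * x \<le> 1 * x" by (intro mult_right_mono) (auto simp: x_def)
      then have "(4 + a) * x \<le> 150 * sqrt m" using x by (simp add: algebra_simps)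
      then show ?thesis by (simp add: algebra_simps)
    qed
    finally show ?thesis unfolding m_def .
  qed
qed

text \<open>The whole vertex set has empty boundary, so above the threshold
  \<open>n \<le> a * card V\<close>, which is of order \<open>n powr (3 / 2)\<close>. Below it the
  targets alone suffice, as \<open>n powr (4 / 3) \<le> n * n \<le> 6000000 * n\<close>; this
  determines the final constant.\<close>

lemma card_ge_of_no_dense_targets:
  fixes E :: "'v \<Rightarrow> 'v \<Rightarrow> bool" and n :: nat
  assumes sym: "symp E" and fin: "finite V"
    and no_minor: "\<And>CC. clique_minor E V CC \<Longrightarrow> card CC \<noteq> 6"
    and small: "\<And>R. R \<subseteq> V \<Longrightarrow> 2 * card R \<le> n \<Longrightarrow> card (X \<inter> R) \<le> card (nbrs E V R)"
    and X: "X \<subseteq> V" "card X = n"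
  shows "real (card V) \<ge> 1 / 6000000 * real n powr (4 / 3)"
proof -
  have nV: "n \<le> card V" using X fin card_mono by blast
  consider "n = 0" | "1 \<le> n" "n < 6000000" | "n \<ge> 6000000" by linarith
  then show ?thesis
  proof cases
    case 1
    then show ?thesis by simp
  next
    case 2
    have "real n powr (4/3) \<le> real n powr 2" using 2 by (intro powr_mono) auto
    also have "\<dots> = real n * real n" using 2 by (simp add: powr_numeral power2_eq_square)
    also have "\<dots> \<le> 6000000 * real n" using 2 by (intro mult_right_mono) auto
    finally show ?thesis using nV by simp
  next
    case 3
    have "boundary E V V = {}" by (simp add: boundary_def)
    moreover have "X \<inter> V = X" using X by blast
    ultimately have "real n \<le> 1000 * sqrt 6 / sqrt n * card V - 1000 * sqrt (card V)"
      using card_targets_le[OF sym fin no_minor small 3, of V] nV X(2) by simp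
    also have "\<dots> \<le> 1000 * sqrt 6 / sqrt n * card V" by simp
    finally have "real n * sqrt n \<le> 1000 * sqrt 6 * card V" using 3 by (simp add: field_simps)
    also have "\<dots> \<le> 6000000 * real (card V)"
    proof -
      have "sqrt 6 \<le> 3" by (rule real_le_lsqrt) auto
      then show ?thesis by (intro mult_right_mono) auto
    qed
    finally have "real n * sqrt n \<le> 6000000 * real (card V)" .
    moreover have "real n powr (4/3) \<le> real n powr (1 + 1/2)" using 3 by (intro powr_mono) auto
    moreover have "real n powr (1 + 1/2) = real n * sqrt n"
      using 3 by (subst powr_add) (simp add: powr_half_sqrt)
    ultimately show ?thesis by simp
  qed
qed

lemma (in arithmetic_circuit) planar_circuit_size:
  fixes M :: "'a mat" and label :: "'e \<Rightarrow> 'a"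
  assumes M: "M \<in> carrier_mat n n" and reg: "totally_regular M" and planar: "planar G"
    and comp: "computes_mult_vec G gate label M"
  shows "real (card (verts G)) \<ge> 1 / 6000000 * real n powr (4 / 3)"
proof -
  obtain out where out: "\<And>i. i < n \<Longrightarrow> out i \<in> verts G \<and>
      computes G gate label (out i) (vec_index (map_mat mconst M *\<^sub>v vec n mvar) i)"
    using comp M unfolding computes_mult_vec_def by (metis carrier_matD(1) carrier_matD(2))
  have inj: "inj_on out {..<n}" by (rule outputs_inj[OF M reg out])
  define E where "E u v \<longleftrightarrow> (\<exists>e\<in>arcs G. tail G e = u \<and> head G e = v \<or>
      tail G e = v \<and> head G e = u)" for u v
  let ?X = "out ` {..<n}"
  show ?thesis
  proof (rule card_ge_of_no_dense_targets[where E = E and X = ?X])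
    show "symp E" by (auto simp: symp_def E_def)
    obtain pt :: "'v \<Rightarrow> complex" and \<gamma> where drawing: "inj_on pt (verts G)"
      "\<forall>e\<in>arcs G. simple_path (\<gamma> e) \<and>
        pathstart (\<gamma> e) = pt (tail G e) \<and> pathfinish (\<gamma> e) = pt (head G e) \<and>
        path_image (\<gamma> e) \<inter> pt ` verts G = {pt (tail G e), pt (head G e)}"
      "\<forall>e\<in>arcs G. \<forall>f\<in>arcs G. e \<noteq> f \<longrightarrow>
        path_image (\<gamma> e) \<inter> path_image (\<gamma> f) \<subseteq> pt ` verts G"
      using planar unfolding planar_def by (elim exE conjE) (rule that)
    show "card CC \<noteq> 6" if minor: "clique_minor E (verts G) CC" for CC
    proof (rule planar_no_K6_minor[of pt "verts G" "arcs G" "tail G" "head G" \<gamma>])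
      show "clique_minor (\<lambda>u v. \<exists>e\<in>arcs G. tail G e = u \<and> head G e = v \<or> tail G e = v \<and> head G e = u)
          (verts G) CC"
        using minor unfolding E_def[abs_def] .
      show "path_image (\<gamma> e) \<inter> path_image (\<gamma> f) \<subseteq> pt ` verts G"
        if "e \<in> arcs G" "f \<in> arcs G" "e \<noteq> f" for e f
        using drawing(3) that by simp
    qed (use drawing in auto)
    show "card (?X \<inter> R) \<le> card (nbrs E (verts G) R)" if R: "R \<subseteq> verts G" "2 * card R \<le> n" for R
    proof -
      have "?X \<inter> R = out ` {i. i < n \<and> out i \<in> R}" by auto
      then have "card (?X \<inter> R) \<le> card {i. i < n \<and> out i \<in> R}" by (simp add: card_image_le)
      also have "\<dots> \<le> card {u \<in> verts G - R. \<exists>e\<in>arcs G. tail G e = u \<and> head G e \<in> R}"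
        using out by (intro outputs_le_boundary[OF M reg _ inj R]) blast
      also have "\<dots> \<le> card (nbrs E (verts G) R)"
        by (intro card_mono) (auto simp: nbrs_def E_def)
      finally show ?thesis .
    qed
    show "card ?X = n" using card_image[OF inj] by simp
  qed (use out in auto)
qed

theorem theorem1p6:
  shows "\<exists>c::real. c > 0 \<and>
    (\<forall>(n::nat) (M :: 'a::field mat) (G :: ('v, 'e) pre_digraph) gate label.
      M \<in> carrier_mat n n \<longrightarrow>
      totally_regular M \<longrightarrow>
      arithmetic_circuit G gate \<longrightarrow>
      planar G \<longrightarrow>
      computes_mult_vec G gate label M \<longrightarrow>
      real (card (verts G)) \<ge> c * real n powr (4 / 3))"
  using arithmetic_circuit.planar_circuit_size
  by (intro exI[of _ "1 / 6000000"]) auto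

end
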